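(* Let $(\mathbf X_i,\varepsilon_i)$, $1\le i\le n$, be i.i.d. pairs satisfying assumptions (Q) and (N) of the context (with constants $C_X$ and $\sigma$), and let $Y_i=\mathbf X_i^\top\boldsymbol\theta^\circ+\varepsilon_i$ with $\boldsymbol\theta^\circ\in\mathbb R^d$. Fix $\delta\in(0,1)$ and $\rho_0\in(0,1/8]$. Suppose that $n\ge2^{12}(1+C_X)^2(\mathtt r(\Sigma)+\log(2/\delta))$ and that $\mu,\lambda>0$ satisfy $$\|\boldsymbol\theta^\circ\|\le\frac{\rho_0\mu}7,\qquad \|\Sigma\|\,\|\boldsymbol\theta^\circ\|\le\frac{\rho_0\mu\sqrt\lambda}{56\cdot18},$$ $$\lambda\ge\frac{2^{13}(1+C_X)\|\Sigma\|^2\|\boldsymbol\theta^\circ\|}{\rho_0\mu}\sqrt{\frac{4\,\mathtt r(\Sigma)+\log(2/\delta)}n},$$ $$\min\left\{\frac\lambda{\|\Sigma\|},\sqrt\lambda\right\}\ge\frac{2^{11}\sigma\|\Sigma\|^{1/2}}{\rho_0\mu}\sqrt{\frac{\mathtt r(\Sigma)+\log(4/\delta)}n}.$$ Let $\widehat{\boldsymbol\theta}$ be the $\boldsymbol\theta$-component of a minimizer of the objective $\mathtt L$ defined in the context. Let $A_0=\widehat\Sigma$ and, for $t=1,\dots,T$ (with $T\ge1$), $$\boldsymbol\theta_t=(A_{t-1}^\top A_{t-1}+2\lambda I_d)^{-1}A_{t-1}^\top\mathbf Z,\qquad A_t=\mathbf Z\boldsymbol\theta_t^\top\left(2\mu^2I_d+\boldsymbol\theta_t\boldsymbol\theta_t^\top\right)^{-1}+\widehat\Sigma\left(I_d+\frac{\boldsymbol\theta_t\boldsymbol\theta_t^\top}{2\mu^2}\right)^{-1}.$$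 Then, with probability at least $1-\delta$, $$\|\boldsymbol\theta_T-\widehat{\boldsymbol\theta}\|\le\rho_0^{2(T-1)}\left(\|\boldsymbol\theta^\circ\|+8\sigma\|\Sigma\|^{1/2}\sqrt{\frac{\mathtt r(\Sigma)+\log(4/\delta)}{\lambda n}}\right).$$
   Context: Notation: $\|\cdot\|$ is the Euclidean norm of vectors and the operator norm of matrices, $\|\cdot\|_{\rm F}$ the Frobenius norm. For a nonzero symmetric positive semidefinite $B$, the effective rank is $\mathtt r(B)=\mathrm{Tr}(B)/\|B\|$. For a random variable $\xi$, $\|\xi\|_{\psi_1}=\inf\{t>0:\mathbb E e^{|\xi|/t}\le2\}$; for a random vector $\boldsymbol\nu$, $\|\boldsymbol\nu\|_{\psi_1}=\sup_{\|\mathbf u\|=1}\|\mathbf u^\top\boldsymbol\nu\|_{\psi_1}$. The vectors $\mathbf X,\mathbf X_1,\dots,\mathbf X_n\in\mathbb R^d$ are i.i.d. with $\mathbb E\|\mathbf X\|^2<\infty$, and $\Sigma=\mathbb E\mathbf X\mathbf X^\top$ is invertible. (Q) There is a constant $C_X>0$ such that for every nonzero $M\in\mathbb R^{d\times d}$ and every real $s$ with $C_X|s|\le1/\|M\|_{\rm F}$, $$\log\mathbb E\exp\{s(\Sigma^{-1/2}\mathbf X)^\top M(\Sigma^{-1/2}\mathbf X)\}\le s\,\mathrm{Tr}(M)+C_X^2s^2\|M\|_{\rm F}^2 .$$ (N) The i.i.d. pairs $(\mathbf X_i,\varepsilon_i)\in\mathbb R^d\times\mathbb R$ satisfy $\mathbb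 E(\varepsilon_1\mid\mathbf X_1)=0$, $\mathbb E\mathbf X_1\mathbf X_1^\top=\Sigma$ and $\|\Sigma^{-1/2}\mathbf X_1\varepsilon_1\|_{\psi_1}=\sigma<\infty$. Put $\widehat\Sigma=\frac1n\sum_{i=1}^n\mathbf X_i\mathbf X_i^\top$ and $\mathbf Z=\frac1n\sum_{i=1}^n\mathbf X_iY_i$. For $(\boldsymbol\theta,\boldsymbol\eta,A)\in\mathbb R^d\times\mathbb R^d\times\mathbb R^{d\times d}$, $$\mathtt L(\boldsymbol\theta,\boldsymbol\eta,A)=\tfrac12\|\mathbf Z-\boldsymbol\eta\|^2+\tfrac12\|\boldsymbol\eta-A\boldsymbol\theta\|^2+\tfrac{\mu^2}2\|\widehat\Sigma-A\|_{\rm F}^2+\tfrac\lambda2\|\boldsymbol\theta\|^2 .$$ *)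

theory Defs
  imports "HOL-Probability.Probability"
begin

definition op_norm :: "real^'d^'d \<Rightarrow> real" where
  "op_norm B = onorm ((*v) B)"

definition frob_norm :: "real^'d^'d \<Rightarrow> real" where
  "frob_norm B = sqrt (\<Sum>i\<in>UNIV. \<Sum>j\<in>UNIV. (B $ i $ j)\<^sup>2)"

text \<open>The library norm on \<open>real^'d^'d\<close> is the Frobenius norm.\<close>

lemma frob_norm_eq_norm: "frob_norm B = norm B"
  by (simp add: frob_norm_def norm_vec_def L2_set_def sum_nonneg)

definition eff_rank :: "real^'d^'d \<Rightarrow> real" where
  "eff_rank B = trace B / op_norm B"

definition outer :: "real^'d \<Rightarrow> real^'d \<Rightarrow> real^'d^'d" where
  "outer x y = (\<chi> i j. x $ i * y $ j)"

lemma outer_mult_vec: "outer x y *v z = (y \<bullet> z) *\<^sub>R x"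
  by (simp add: outer_def matrix_vector_mult_def inner_vec_def vec_eq_iff
      sum_distrib_left mult_ac)

definition psd :: "real^'d^'d \<Rightarrow> bool" where
  "psd B \<longleftrightarrow> transpose B = B \<and> (\<forall>x. 0 \<le> x \<bullet> (B *v x))"

text \<open>The unique positive semidefinite square root; meaningful for positive semidefinite
  arguments only.\<close>

definition psd_sqrt :: "real^'d^'d \<Rightarrow> real^'d^'d" where
  "psd_sqrt B = (THE R. psd R \<and> R ** R = B)"

definition inv_sqrt :: "real^'d^'d \<Rightarrow> real^'d^'d" where
  "inv_sqrt B = matrix_inv (psd_sqrt B)"

text \<open>The Orlicz norms take values in \<open>[0, \<infinity>]\<close>: the infimum over the empty set is \<open>\<infinity>\<close>.\<close>

definition psi1_norm :: "'w measure \<Rightarrow> ('w \<Rightarrow> real) \<Rightarrow> ennreal" where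
  "psi1_norm M \<xi> =
     (INF t\<in>{t::real. 0 < t \<and> (\<integral>\<^sup>+w. ennreal (exp (\<bar>\<xi> w\<bar> / t)) \<partial>M) \<le> 2}. ennreal t)"

definition psi1_norm_vec :: "'w measure \<Rightarrow> ('w \<Rightarrow> real^'d) \<Rightarrow> ennreal" where
  "psi1_norm_vec M \<nu> = (SUP u\<in>{u. norm u = 1}. psi1_norm M (\<lambda>w. u \<bullet> \<nu> w))"

text \<open>The integrability clause expresses that the expectation is finite, which the informal
  inequality (with \<open>log \<infinity> = \<infinity>\<close>) entails; the Bochner integral of a non-integrable
  function would be \<open>0\<close>.\<close>

definition quadratic_mgf_bound ::
    "'w measure \<Rightarrow> ('w \<Rightarrow> real^'d) \<Rightarrow> real^'d^'d \<Rightarrow> real \<Rightarrow> bool" where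
  "quadratic_mgf_bound M X S C \<longleftrightarrow>
     (\<forall>B s. B \<noteq> 0 \<longrightarrow> C * \<bar>s\<bar> \<le> 1 / frob_norm B \<longrightarrow>
        integrable M (\<lambda>w. exp (s * ((inv_sqrt S *v X w) \<bullet> (B *v (inv_sqrt S *v X w))))) \<and>
        ln (integral\<^sup>L M (\<lambda>w. exp (s * ((inv_sqrt S *v X w) \<bullet> (B *v (inv_sqrt S *v X w))))))
          \<le> s * trace B + C\<^sup>2 * s\<^sup>2 * (frob_norm B)\<^sup>2)"

definition objective ::
    "real^'d \<Rightarrow> real^'d^'d \<Rightarrow> real \<Rightarrow> real \<Rightarrow> (real^'d) \<times> (real^'d) \<times> (real^'d^'d) \<Rightarrow> real" where
  "objective Z S \<mu> lam = (\<lambda>(\<theta>, \<eta>, A).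
     1/2 * (norm (Z - \<eta>))\<^sup>2 + 1/2 * (norm (\<eta> - A *v \<theta>))\<^sup>2
     + \<mu>\<^sup>2 / 2 * (frob_norm (S - A))\<^sup>2 + lam / 2 * (norm \<theta>)\<^sup>2)"

end

theory Submission
  imports Defs
begin

text \<open>
  Write \<open>S\<close> for the sample covariance, \<open>\<zeta>\<close> for the average of \<open>\<epsilon>\<^sub>i X\<^sub>i\<close>, so that \<open>Z = S \<theta>\<^sup>\<circ> + \<zeta>\<close>,
  and \<open>N = \<parallel>\<theta>\<^sup>\<circ>\<parallel> + \<parallel>\<zeta>\<parallel> / \<surd>\<lambda>\<close>. The proof separates a deterministic contraction from two
  concentration bounds.

  \<^emph>\<open>Contraction.\<close> Minimising out \<open>\<eta>\<close> turns the objective into half of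
  \<open>\<parallel>Z - A \<theta>\<parallel>\<^sup>2 / 2 + \<mu>\<^sup>2 \<parallel>S - A\<parallel>\<^sup>2 + \<lambda> \<parallel>\<theta>\<parallel>\<^sup>2\<close>, and the iteration minimises this alternately in
  \<open>\<theta>\<close> and \<open>A\<close>. A global minimiser is a fixed point of both updates, and comparing its value with
  that of \<open>(\<theta>\<^sup>\<circ>, S)\<close> gives \<open>\<parallel>\<theta>hat\<parallel> \<le> N\<close>. The update of \<open>A\<close> is Lipschitz in \<open>\<theta>\<close> on the ball of
  radius \<open>2 N\<close>, with a constant of order \<open>\<rho>\<^sub>0 \<surd>\<lambda> / \<mu>\<close> (\<open>operator_step_lipschitz\<close>); the ridge update
  of \<open>\<theta>\<close>, compared with the fixed point, moves by at most \<open>N / \<surd>\<lambda>\<close> times the change of \<open>A\<close>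
  (\<open>ridge_perturbation\<close>). Since \<open>N \<le> \<rho>\<^sub>0 \<mu> / 6\<close>, one full round contracts the distance to \<open>\<theta>hat\<close> by
  \<open>\<rho>\<^sub>0\<^sup>2 / 6\<close>. The start \<open>A\<^sub>0 = S\<close> is the update at \<open>\<theta> = 0\<close>, whose distance to \<open>\<theta>hat\<close> is at most
  \<open>N\<close>. This is \<open>alternating_minimization_contraction\<close>. Of the data it uses only that the operator
  norm of \<open>S\<close> is bounded by a multiple of that of \<open>\<Sigma>\<close> and that \<open>\<parallel>\<zeta>\<parallel>\<close> is small.

  \<^emph>\<open>Concentration.\<close> Both remaining facts are bounds, uniform over unit vectors \<open>u\<close>, on an empirical
  sum \<open>F(u)\<close> that is linear (noise) or quadratic (covariance) in \<open>u\<close>. The effective rank enters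
  through a Gaussian average: let \<open>R\<close> be the square root of \<open>\<Sigma>\<close> and let \<open>x\<close> be standard Gaussian.
  Shifting the Gaussian by \<open>\<beta> u\<close> and symmetrising, convexity of \<open>F\<close> yields
  \<open>exp (F(\<beta> u) - \<beta>\<^sup>2 / 2) / 2 \<le> \<integral> exp (F x)\<close>, where the integral extends over the vectors \<open>x\<close> for which
  \<open>\<parallel>R x\<parallel>\<close> is at most \<open>2 \<surd>(Tr \<Sigma>) + \<beta> \<surd>\<parallel>\<Sigma>\<parallel>\<close> (\<open>gauss_smoothing\<close>). The right-hand side does not depend
  on \<open>u\<close>, and its expectation is controlled by exponential moments at fixed \<open>x\<close>, so Markov's
  inequality gives the uniform bound (\<open>variational_tail_bound\<close>). With \<open>\<beta>\<^sup>2\<close> equal to the effective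
  rank plus the logarithm of the inverse confidence level, assumption (Q) for rank-one matrices gives
  \<open>sample_covariance_bound\<close> and the \<open>\<psi>\<^sub>1\<close> assumption gives \<open>psi1_norm_vec_mean_bound\<close>.
\<close>

section \<open>Symmetric matrices and the positive semidefinite square root\<close>

text \<open>First-order optimality without derivatives: whenever a minimiser is perturbed along a line, the
  objectives occurring here are quadratic polynomials in the step \<open>t\<close>.\<close>
lemma linear_term_eq_0:
  fixes b c :: real
  assumes "\<And>t. b * t + c * t\<^sup>2 \<ge> 0"
  shows "b = 0"
proof (rule ccontr)
  assume "b \<noteq> 0"
  \<comment> \<open>Any step \<open>- b / k\<close> with \<open>k > c\<close> makes the linear term win.\<close>
  define k where "k = \<bar>c\<bar> + 1"
  have k: "k > 0" "c \<le> k - 1" by (auto simp: k_def)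
  have "0 \<le> b * (- b / k) + c * (- b / k)\<^sup>2" by (rule assms)
  also have "\<dots> = (b\<^sup>2 / k\<^sup>2) * (c - k)"
    using k by (simp add: field_simps power2_eq_square)
  also have "\<dots> < 0" using k \<open>b \<noteq> 0\<close> by (intro mult_pos_neg) auto
  finally show False by simp
qed

lemma norm_outer: "norm (outer x y) = norm x * norm y"
proof -
  have "(norm (outer x y))\<^sup>2 = (norm x)\<^sup>2 * (norm y)\<^sup>2"
    unfolding power2_norm_eq_inner
    by (simp add: outer_def inner_vec_def sum_product mult_ac)
  thus ?thesis by (metis norm_ge_zero power2_eq_iff_nonneg power_mult_distrib mult_nonneg_nonneg)
qed

lemma norm_matrix_vector_mult_le: 
  fixes A :: "real^'n^'m"
  shows "norm (A *v x) \<le> norm A * norm x"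
proof -
  have "(norm (A *v x))\<^sup>2 = (\<Sum>i\<in>UNIV. (A $ i \<bullet> x)\<^sup>2)"
    by (simp add: norm_vec_def L2_set_def sum_nonneg matrix_vector_mult_def inner_vec_def)
  also have "\<dots> \<le> (\<Sum>i\<in>UNIV. (norm (A $ i))\<^sup>2 * (norm x)\<^sup>2)"
    by (intro sum_mono) (metis Cauchy_Schwarz_ineq power2_norm_eq_inner)
  also have "\<dots> = (norm A * norm x)\<^sup>2"
    by (simp add: norm_vec_def[of A] L2_set_def sum_nonneg sum_distrib_right power_mult_distrib)
  finally show ?thesis by (rule power2_le_imp_le) simp
qed

lemma symmetric_inner:
  assumes "transpose B = B"
  shows "x \<bullet> (B *v y) = (B *v x) \<bullet> (y :: real^'d)"
  by (metis assms dot_lmul_matrix vector_transpose_matrix)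

lemma inner_outer: "outer x y \<bullet> H = x \<bullet> (H *v y)"
  by (simp add: outer_def inner_vec_def matrix_vector_mult_def sum_distrib_left mult_ac)

lemma trace_outer: "trace (outer x y) = x \<bullet> y"
  by (simp add: trace_def outer_def inner_vec_def)

text \<open>A maximiser \<open>v\<close> of the quadratic form on the unit sphere of \<open>V\<close>, with value \<open>l\<close>, is an
  eigenvector: perturbing it in a direction of \<open>V\<close> shows that \<open>B v - l v\<close> is orthogonal to \<open>V\<close>, and
  this vector itself lies in \<open>V\<close>.\<close>
lemma symmetric_eigenvector_exists:
  fixes B :: "real^'d^'d"
  assumes sym: "transpose B = B" and V: "subspace V" "\<And>x. x \<in> V \<Longrightarrow> B *v x \<in> V"
    and nz: "V \<noteq> {0}"
  shows "\<exists>v\<in>V. norm v = 1 \<and> B *v v = (v \<bullet> (B *v v)) *\<^sub>R v"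
proof -
  let ?S = "sphere 0 1 \<inter> V"
  have "compact ?S" by (intro compact_Int_closed closed_subspace V) auto
  moreover have "?S \<noteq> {}"
  proof -
    obtain x where "x \<in> V" "x \<noteq> 0" using nz subspace_0[OF V(1)] by blast
    hence "x /\<^sub>R norm x \<in> ?S" using V(1) by (auto simp: subspace_scale)
    thus ?thesis by blast
  qed
  moreover have "continuous_on ?S (\<lambda>x. x \<bullet> (B *v x))"
    by (intro continuous_intros linear_continuous_on matrix_vector_mul_bounded_linear)
  ultimately obtain v where v: "v \<in> ?S" and max: "\<And>x. x \<in> ?S \<Longrightarrow> x \<bullet> (B *v x) \<le> v \<bullet> (B *v v)"
    using continuous_attains_sup by meson
  define l where "l = v \<bullet> (B *v v)"
  have vV: "v \<in> V" and nv: "norm v = 1" using v by auto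
  have le: "x \<bullet> (B *v x) \<le> l * (x \<bullet> x)" if "x \<in> V" for x
  proof (cases "x = 0")
    case False
    have "x /\<^sub>R norm x \<in> ?S" using that V(1) False by (auto simp: subspace_scale)
    from max[OF this] have "(x \<bullet> (B *v x)) / (norm x)\<^sup>2 \<le> l"
      by (simp add: l_def matrix_vector_mult_scaleR power2_eq_square field_simps)
    thus ?thesis using False by (simp add: field_simps power2_norm_eq_inner)
  qed simp
  have orth: "h \<bullet> (B *v v - l *\<^sub>R v) = 0" if "h \<in> V" for h
  proof -
    have "(-2 * (h \<bullet> (B *v v - l *\<^sub>R v))) * t + (l * (h \<bullet> h) - h \<bullet> (B *v h)) * t\<^sup>2 \<ge> 0" for t
    proof -
      have "v + t *\<^sub>R h \<in> V" using that vV V(1) by (simp add: subspace_add subspace_scale)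
      from le[OF this] have "(v + t *\<^sub>R h) \<bullet> (B *v (v + t *\<^sub>R h)) \<le> l * ((v + t *\<^sub>R h) \<bullet> (v + t *\<^sub>R h))" .
      moreover have "v \<bullet> (B *v h) = h \<bullet> (B *v v)"
        using symmetric_inner[OF sym] by (metis inner_commute)
      moreover have "v \<bullet> v = 1" using nv by (simp add: dot_square_norm)
      ultimately show ?thesis
        by (simp add: l_def matrix_vector_right_distrib matrix_vector_mult_scaleR inner_simps
            inner_commute power2_eq_square algebra_simps)
    qed
    from linear_term_eq_0[OF this] show ?thesis by simp
  qed
  have "B *v v - l *\<^sub>R v \<in> V" using vV V by (simp add: subspace_diff subspace_scale)
  from orth[OF this] have "B *v v = l *\<^sub>R v" by simp
  thus ?thesis using vV nv unfolding l_def by blast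
qed

text \<open>Split off one eigenvector; by symmetry its orthogonal complement inside \<open>V\<close> is invariant again
  and has smaller dimension.\<close>
lemma symmetric_eigenbasis_subspace:
  fixes B :: "real^'d^'d"
  assumes sym: "transpose B = B" and V: "subspace V" "\<And>x. x \<in> V \<Longrightarrow> B *v x \<in> V"
  shows "\<exists>E. finite E \<and> pairwise orthogonal E \<and> span E = V \<and>
    (\<forall>v\<in>E. norm v = 1 \<and> B *v v = (v \<bullet> (B *v v)) *\<^sub>R v)"
  using V
proof (induction "dim V" arbitrary: V rule: less_induct)
  case less
  show ?case
  proof (cases "V = {0}")
    case True
    thus ?thesis by (intro exI[of _ "{}"]) auto
  next
    case False
    then obtain v where v: "v \<in> V" "norm v = 1" "B *v v = (v \<bullet> (B *v v)) *\<^sub>R v"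
      using symmetric_eigenvector_exists[OF sym less.prems] by blast
    define U where "U = {x \<in> V. v \<bullet> x = 0}"
    have U: "subspace U"
      using less.prems(1) unfolding U_def subspace_def by (auto simp: inner_simps)
    have inv: "B *v x \<in> U" if "x \<in> U" for x
    proof -
      have "v \<bullet> (B *v x) = (B *v v) \<bullet> x" by (rule symmetric_inner[OF sym])
      also have "\<dots> = 0" using that v(3) unfolding U_def by (metis (mono_tags, lifting) inner_scaleR_left mem_Collect_eq mult_zero_right)
      finally show ?thesis using that less.prems(2) by (auto simp: U_def)
    qed
    have "v \<notin> U" using v(2) by (auto simp: U_def dot_square_norm)
    hence "U \<subset> V" using v(1) unfolding U_def by (metis (no_types, lifting) mem_Collect_eq psubsetI subsetI)
    hence "dim U < dim V" using U less.prems(1) by (metis dim_psubset span_eq_iff)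
    from less.hyps[OF this U inv] obtain E where E: "finite E" "pairwise orthogonal E" "span E = U"
      "\<forall>v\<in>E. norm v = 1 \<and> B *v v = (v \<bullet> (B *v v)) *\<^sub>R v" by blast
    have sub: "E \<subseteq> U" using E(3) span_superset by blast
    have "span (insert v E) = V"
    proof
      show "span (insert v E) \<subseteq> V"
        using sub v(1) less.prems(1) by (intro span_minimal) (auto simp: U_def)
      show "V \<subseteq> span (insert v E)"
      proof
        fix x assume x: "x \<in> V"
        have "x - (v \<bullet> x) *\<^sub>R v \<in> U"
          using x v(1,2) less.prems(1)
          by (auto simp: U_def subspace_diff subspace_scale inner_diff_right dot_square_norm)
        thus "x \<in> span (insert v E)" unfolding span_insert E(3) by blast
      qed
    qed
    moreover have "pairwise orthogonal (insert v E)"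
      using E(2) sub by (auto simp: pairwise_insert U_def orthogonal_def inner_commute)
    ultimately show ?thesis using E v by (intro exI[of _ "insert v E"]) auto
  qed
qed

lemma symmetric_eigenbasis:
  fixes B :: "real^'d^'d"
  assumes "transpose B = B"
  obtains E where "finite E" "pairwise orthogonal E" "span E = UNIV"
    "\<And>v. v \<in> E \<Longrightarrow> norm v = 1" "\<And>v. v \<in> E \<Longrightarrow> B *v v = (v \<bullet> (B *v v)) *\<^sub>R v"
  using symmetric_eigenbasis_subspace[OF assms, of UNIV] by auto

lemma matrix_eq_on_span:
  fixes A B :: "real^'d^'d"
  assumes "span E = UNIV" "\<And>v. v \<in> E \<Longrightarrow> A *v v = B *v v"
  shows "A = B"
  unfolding matrix_eq
  using linear_eq_on_span[of "(*v) A" "(*v) B" E] assms by (auto simp: matrix_vector_mul_linear)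

lemma psd_sqrt_exists:
  assumes "psd B"
  shows "\<exists>R. psd R \<and> R ** R = B"
proof -
  have sym: "transpose B = B" and pos: "\<And>x. 0 \<le> x \<bullet> (B *v x)" using assms by (auto simp: psd_def)
  from symmetric_eigenbasis[OF sym] obtain E where E: "finite E" "pairwise orthogonal E" "span E = UNIV"
    "\<And>v. v \<in> E \<Longrightarrow> norm v = 1" "\<And>v. v \<in> E \<Longrightarrow> B *v v = (v \<bullet> (B *v v)) *\<^sub>R v" by metis
  define l where "l v = v \<bullet> (B *v v)" for v
  define R where "R = (\<Sum>v\<in>E. sqrt (l v) *\<^sub>R outer v v)"
  have Rx: "R *v x = (\<Sum>v\<in>E. (sqrt (l v) * (v \<bullet> x)) *\<^sub>R v)" for x
    unfolding R_def using E(1)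
    by (induction E rule: finite_induct)
      (auto simp: matrix_vector_mult_add_rdistrib scaleR_matrix_vector_assoc[symmetric] outer_mult_vec)
  have Rv: "R *v u = sqrt (l u) *\<^sub>R u" if "u \<in> E" for u
  proof -
    have "R *v u = (\<Sum>v\<in>E. if v = u then sqrt (l u) *\<^sub>R u else 0)"
      unfolding Rx using E(2,4) that
      by (intro sum.cong) (auto simp: pairwise_def orthogonal_def dot_square_norm)
    thus ?thesis using E(1) that by simp
  qed
  have "transpose R = R"
    unfolding R_def using E(1)
    by (induction E rule: finite_induct)
      (auto simp: transpose_def outer_def vec_eq_iff mult.commute)
  moreover have "0 \<le> x \<bullet> (R *v x)" for x
  proof -
    have "x \<bullet> (R *v x) = (\<Sum>v\<in>E. sqrt (l v) * (v \<bullet> x)\<^sup>2)"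
      unfolding Rx inner_sum_right by (simp add: power2_eq_square inner_commute mult_ac)
    thus ?thesis using pos by (auto simp: l_def intro!: sum_nonneg)
  qed
  moreover have "R ** R = B"
  proof (rule matrix_eq_on_span[OF E(3)])
    fix v assume v: "v \<in> E"
    have "(R ** R) *v v = (sqrt (l v) * sqrt (l v)) *\<^sub>R v"
      by (simp add: matrix_vector_mul_assoc[symmetric] Rv[OF v] matrix_vector_mult_scaleR)
    also have "\<dots> = B *v v" using E(5)[OF v] pos by (simp add: l_def)
    finally show "(R ** R) *v v = B *v v" .
  qed
  ultimately show ?thesis unfolding psd_def by blast
qed

text \<open>A zero of a nonnegative quadratic form is a minimiser, so the gradient vanishes there.\<close>
lemma psd_kernel:
  assumes "psd R" "x \<bullet> (R *v x) = 0"
  shows "R *v x = 0"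
proof -
  have sym: "transpose R = R" using assms by (simp add: psd_def)
  let ?h = "R *v x"
  have "(2 * (?h \<bullet> ?h)) * t + (?h \<bullet> (R *v ?h)) * t\<^sup>2 \<ge> 0" for t
  proof -
    have "0 \<le> (x + t *\<^sub>R ?h) \<bullet> (R *v (x + t *\<^sub>R ?h))" using assms by (simp add: psd_def)
    moreover have "x \<bullet> (R *v ?h) = ?h \<bullet> ?h" by (rule symmetric_inner[OF sym])
    ultimately show ?thesis using assms(2)
      by (simp add: matrix_vector_right_distrib matrix_vector_mult_scaleR inner_simps
            power2_eq_square algebra_simps)
  qed
  from linear_term_eq_0[OF this] show ?thesis by simp
qed

text \<open>Put \<open>D = R - Q\<close>. Testing \<open>R\<^sup>2 = Q\<^sup>2\<close> on an eigenvector \<open>v\<close> of \<open>D\<close> with eigenvalue \<open>l\<close> gives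
  \<open>l (v \<bullet> R v + v \<bullet> Q v) = 0\<close>. If \<open>l\<close> is not zero, semidefiniteness forces \<open>R v = Q v = 0\<close>. Hence \<open>D\<close>
  vanishes on an eigenbasis.\<close>
lemma psd_sqrt_unique:
  assumes R: "psd R" and Q: "psd Q" and eq: "R ** R = Q ** Q"
  shows "R = Q"
proof -
  let ?D = "R - Q"
  have sR: "transpose R = R" and sQ: "transpose Q = Q" using R Q by (auto simp: psd_def)
  have symD: "transpose ?D = ?D" using sR sQ by (auto simp: transpose_def vec_eq_iff)
  from symmetric_eigenbasis[OF symD] obtain E where E: "span E = UNIV"
    "\<And>v. v \<in> E \<Longrightarrow> norm v = 1" "\<And>v. v \<in> E \<Longrightarrow> ?D *v v = (v \<bullet> (?D *v v)) *\<^sub>R v" by metis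
  show ?thesis
  proof (rule matrix_eq_on_span[OF E(1)])
    fix v assume v: "v \<in> E"
    define l where "l = v \<bullet> (?D *v v)"
    have Dv: "?D *v v = l *\<^sub>R v" using E(3)[OF v] by (simp add: l_def)
    have Rv: "R *v v = Q *v v + l *\<^sub>R v" using Dv by (simp add: matrix_vector_mult_diff_rdistrib algebra_simps)
    have "R *v (R *v v) = Q *v (Q *v v)" using eq by (simp add: matrix_vector_mul_assoc)
    hence "(R *v v) \<bullet> (R *v v) = (Q *v v) \<bullet> (Q *v v)"
      using symmetric_inner[OF sR, of v "R *v v"] symmetric_inner[OF sQ, of v "Q *v v"] by simp
    hence "l * (v \<bullet> (Q *v v) + v \<bullet> (R *v v)) = 0"
      unfolding Rv by (simp add: inner_simps inner_commute algebra_simps)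
    moreover have "0 \<le> v \<bullet> (Q *v v)" "0 \<le> v \<bullet> (R *v v)" using R Q by (auto simp: psd_def)
    ultimately have "l = 0 \<or> (v \<bullet> (Q *v v) = 0 \<and> v \<bullet> (R *v v) = 0)" by (auto simp: add_nonneg_eq_0_iff)
    thus "R *v v = Q *v v" using Rv psd_kernel[OF R] psd_kernel[OF Q] by force
  qed
qed

lemma psd_sqrt:
  assumes "psd B"
  shows "psd (psd_sqrt B)" "psd_sqrt B ** psd_sqrt B = B"
proof -
  have "\<exists>!R. psd R \<and> R ** R = B"
    using psd_sqrt_exists[OF assms] psd_sqrt_unique by metis
  from theI'[OF this] show "psd (psd_sqrt B)" "psd_sqrt B ** psd_sqrt B = B"
    unfolding psd_sqrt_def by auto
qed

lemma matrix_mul_matrix_inv: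
  fixes B :: "real^'d^'d"
  assumes "invertible B"
  shows "B ** matrix_inv B = mat 1"
proof -
  have "\<exists>C. B ** C = mat 1 \<and> C ** B = mat 1" using assms by (simp add: invertible_def)
  from someI_ex[OF this] show ?thesis unfolding matrix_inv_def by blast
qed

lemma psd_sqrt_inv_sqrt:
  assumes "psd B" "invertible B"
  shows "psd_sqrt B ** inv_sqrt B = mat 1"
proof -
  let ?R = "psd_sqrt B"
  obtain C where "B ** C = mat 1" using assms(2) by (auto simp: invertible_def)
  hence "?R ** (?R ** C) = mat 1" by (metis matrix_mul_assoc psd_sqrt(2)[OF assms(1)])
  hence "invertible ?R" using invertible_right_inverse by blast
  thus ?thesis unfolding inv_sqrt_def by (rule matrix_mul_matrix_inv)
qed

lemma op_norm_bound: "norm (B *v x) \<le> op_norm B * norm x"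
  unfolding op_norm_def by (rule onorm) (rule matrix_vector_mul_bounded_linear)

lemma norm_psd_sqrt_mult:
  assumes "psd B"
  shows "(norm (psd_sqrt B *v x))\<^sup>2 = x \<bullet> (B *v x)"
proof -
  have "transpose (psd_sqrt B) = psd_sqrt B" using psd_sqrt(1)[OF assms] by (simp add: psd_def)
  from symmetric_inner[OF this, of x "psd_sqrt B *v x"] show ?thesis
    by (simp add: matrix_vector_mul_assoc psd_sqrt(2)[OF assms] dot_square_norm)
qed

lemma norm_psd_sqrt:
  assumes "psd B"
  shows "(norm (psd_sqrt B))\<^sup>2 = trace B"
proof -
  let ?R = "psd_sqrt B"
  have sym: "transpose ?R = ?R" using psd_sqrt(1)[OF assms] by (simp add: psd_def)
  have "trace (?R ** ?R) = trace (transpose ?R ** ?R)" by (simp add: sym)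
  also have "\<dots> = (norm ?R)\<^sup>2"
    unfolding trace_def matrix_matrix_mult_def transpose_def power2_norm_eq_inner
    by (simp add: inner_vec_def) (rule sum.swap)
  finally show ?thesis by (simp add: psd_sqrt(2)[OF assms])
qed

section \<open>The reduced objective and its stationary points\<close>

lemma power2_norm_add_scaleR:
  fixes a b :: "'a::real_inner"
  shows "(norm (a + t *\<^sub>R b))\<^sup>2 = (norm a)\<^sup>2 + 2 * t * (a \<bullet> b) + t\<^sup>2 * (norm b)\<^sup>2"
  unfolding power2_norm_eq_inner by (simp add: inner_simps power2_eq_square inner_commute[of b a] distrib_left)

text \<open>At fixed \<open>(\<theta>, A)\<close> the best \<open>\<eta>\<close> is the midpoint of \<open>Z\<close> and \<open>A \<theta>\<close>, which leaves half of the
  functional compared here.\<close>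
lemma is_arg_min_objective_residual:
  fixes Z \<theta>hat :: "real^'d" and S Ah :: "real^'d^'d"
  assumes "is_arg_min (objective Z S \<mu> lam) (\<lambda>_. True) (\<theta>hat, \<eta>h, Ah)"
  shows "1/2 * (norm (Z - Ah *v \<theta>hat))\<^sup>2 + \<mu>\<^sup>2 * (norm (S - Ah))\<^sup>2 + lam * (norm \<theta>hat)\<^sup>2
    \<le> 1/2 * (norm (Z - A *v \<theta>))\<^sup>2 + \<mu>\<^sup>2 * (norm (S - A))\<^sup>2 + lam * (norm \<theta>)\<^sup>2"
proof -
  define \<eta> where "\<eta> = (1/2) *\<^sub>R (Z + A *v \<theta>)"
  have "objective Z S \<mu> lam (\<theta>hat, \<eta>h, Ah) \<le> objective Z S \<mu> lam (\<theta>, \<eta>, A)"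
    using assms by (auto simp: is_arg_min_def not_less)
  moreover have "(norm (Z - \<eta>))\<^sup>2 + (norm (\<eta> - A *v \<theta>))\<^sup>2 = (norm (Z - A *v \<theta>))\<^sup>2 / 2"
  proof -
    have "Z - \<eta> = (1/2) *\<^sub>R (Z - A *v \<theta>)" "\<eta> - A *v \<theta> = (1/2) *\<^sub>R (Z - A *v \<theta>)"
      by (simp_all add: \<eta>_def vec_eq_iff field_simps)
    thus ?thesis by (simp add: power_divide)
  qed
  moreover have "(norm (Z - Ah *v \<theta>hat))\<^sup>2 \<le> 2 * ((norm (Z - \<eta>h))\<^sup>2 + (norm (\<eta>h - Ah *v \<theta>hat))\<^sup>2)"
  proof -
    have "norm (Z - Ah *v \<theta>hat) \<le> norm (Z - \<eta>h) + norm (\<eta>h - Ah *v \<theta>hat)"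
      by (metis add_diff_eq diff_add_cancel norm_triangle_ineq)
    hence "(norm (Z - Ah *v \<theta>hat))\<^sup>2 \<le> (norm (Z - \<eta>h) + norm (\<eta>h - Ah *v \<theta>hat))\<^sup>2"
      by (intro power_mono) auto
    also have "\<dots> \<le> 2 * ((norm (Z - \<eta>h))\<^sup>2 + (norm (\<eta>h - Ah *v \<theta>hat))\<^sup>2)"
      using sum_squares_bound[of "norm (Z - \<eta>h)" "norm (\<eta>h - Ah *v \<theta>hat)"]
      by (simp add: power2_sum)
    finally show ?thesis .
  qed
  ultimately show ?thesis
    unfolding objective_def frob_norm_eq_norm by (simp add: field_simps)
qed

text \<open>The minimiser over \<open>A\<close> of the reduced functional at fixed \<open>\<theta>\<close>, written as a rank-one correction
  of \<open>S\<close>; the form with two matrix inverses is recovered in \<open>operator_step_closed_form\<close>.\<close>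
definition operator_step :: "real^'d \<Rightarrow> real^'d^'d \<Rightarrow> real \<Rightarrow> real^'d \<Rightarrow> real^'d^'d" where
  "operator_step Z S \<mu> \<theta> = S + (1 / (2 * \<mu>\<^sup>2 + (norm \<theta>)\<^sup>2)) *\<^sub>R outer (Z - S *v \<theta>) \<theta>"

lemma inner_mat_transpose: "x \<bullet> (transpose B *v y) = (B *v x) \<bullet> (y :: real^'d)"
  unfolding transpose_matrix_vector inner_commute[of x] dot_lmul_matrix by (rule inner_commute)

text \<open>Each partial gradient vanishes because the reduced functional is perturbed in the direction of
  that very gradient. The equation for \<open>A\<close> is implicit, with the residual of \<open>Ah\<close> on the right; it is
  solved by computing \<open>Ah *v \<theta>hat\<close> from it first.\<close>
lemma is_arg_min_stationary:
  fixes Z \<theta>hat :: "real^'d" and S Ah :: "real^'d^'d"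
  assumes min: "is_arg_min (objective Z S \<mu> lam) (\<lambda>_. True) (\<theta>hat, \<eta>h, Ah)" and \<mu>: "\<mu> > 0"
  shows "transpose Ah *v (Z - Ah *v \<theta>hat) = (2 * lam) *\<^sub>R \<theta>hat"
    and "Ah = operator_step Z S \<mu> \<theta>hat"
proof -
  define r where "r = Z - Ah *v \<theta>hat"
  note le = is_arg_min_objective_residual[OF min]
  show "transpose Ah *v (Z - Ah *v \<theta>hat) = (2 * lam) *\<^sub>R \<theta>hat"
  proof -
    \<comment> \<open>The gradient in \<open>\<theta>\<close>.\<close>
    define h where "h = (2 * lam) *\<^sub>R \<theta>hat - transpose Ah *v r"
    have "(h \<bullet> h) * t + (1/2 * (norm (Ah *v h))\<^sup>2 + lam * (norm h)\<^sup>2) * t\<^sup>2 \<ge> 0" for t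
    proof -
      have e1: "(norm (Z - Ah *v (\<theta>hat + t *\<^sub>R h)))\<^sup>2 = (norm r)\<^sup>2 - 2 * t * (h \<bullet> (transpose Ah *v r)) + t\<^sup>2 * (norm (Ah *v h))\<^sup>2"
      proof -
        have "Z - Ah *v (\<theta>hat + t *\<^sub>R h) = r - t *\<^sub>R (Ah *v h)"
          by (simp add: r_def matrix_vector_right_distrib matrix_vector_mult_scaleR)
        thus ?thesis unfolding inner_mat_transpose
          using power2_norm_add_scaleR[of r "- t" "Ah *v h"] by (simp add: inner_commute)
      qed
      have e2: "(norm (\<theta>hat + t *\<^sub>R h))\<^sup>2 = (norm \<theta>hat)\<^sup>2 + 2 * t * (h \<bullet> \<theta>hat) + t\<^sup>2 * (norm h)\<^sup>2"
        using power2_norm_add_scaleR[of \<theta>hat t h] by (simp add: inner_commute)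
      have e3: "h \<bullet> h = 2 * lam * (h \<bullet> \<theta>hat) - h \<bullet> (transpose Ah *v r)"
        by (subst (2) h_def) (simp add: inner_simps)
      show ?thesis using le[of Ah "\<theta>hat + t *\<^sub>R h"] unfolding e1 e2 e3 r_def[symmetric]
        by (simp add: algebra_simps)
    qed
    from linear_term_eq_0[OF this] show ?thesis unfolding r_def[symmetric] by (simp add: h_def)
  qed
  have stat: "(2 * \<mu>\<^sup>2) *\<^sub>R (Ah - S) = outer r \<theta>hat"
  proof -
    \<comment> \<open>The gradient in \<open>A\<close>.\<close>
    define H where "H = (2 * \<mu>\<^sup>2) *\<^sub>R (Ah - S) - outer r \<theta>hat"
    have "(H \<bullet> H) * t + (1/2 * (norm (H *v \<theta>hat))\<^sup>2 + \<mu>\<^sup>2 * (norm H)\<^sup>2) * t\<^sup>2 \<ge> 0" for t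
    proof -
      have e1: "(norm (Z - (Ah + t *\<^sub>R H) *v \<theta>hat))\<^sup>2 = (norm r)\<^sup>2 - 2 * t * (outer r \<theta>hat \<bullet> H) + t\<^sup>2 * (norm (H *v \<theta>hat))\<^sup>2"
      proof -
        have "Z - (Ah + t *\<^sub>R H) *v \<theta>hat = r - t *\<^sub>R (H *v \<theta>hat)"
          by (simp add: r_def matrix_vector_mult_add_rdistrib scaleR_matrix_vector_assoc[symmetric])
        thus ?thesis unfolding inner_outer
          using power2_norm_add_scaleR[of r "- t" "H *v \<theta>hat"] by simp
      qed
      have e2: "(norm (S - (Ah + t *\<^sub>R H)))\<^sup>2 = (norm (S - Ah))\<^sup>2 + 2 * t * ((Ah - S) \<bullet> H) + t\<^sup>2 * (norm H)\<^sup>2"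
      proof -
        have "S - (Ah + t *\<^sub>R H) = - ((Ah - S) + t *\<^sub>R H)" by simp
        hence "norm (S - (Ah + t *\<^sub>R H)) = norm ((Ah - S) + t *\<^sub>R H)" by (simp only: norm_minus_cancel)
        thus ?thesis using power2_norm_add_scaleR[of "Ah - S" t H] by (simp add: norm_minus_commute)
      qed
      have e3: "H \<bullet> H = 2 * \<mu>\<^sup>2 * ((Ah - S) \<bullet> H) - outer r \<theta>hat \<bullet> H"
        by (subst (1) H_def) (simp add: inner_simps)
      show ?thesis using le[of "Ah + t *\<^sub>R H" \<theta>hat] unfolding e1 e2 e3 r_def[symmetric]
        by (simp add: algebra_simps)
    qed
    from linear_term_eq_0[OF this] show ?thesis by (simp add: H_def)
  qed
  define k where "k = 2 * \<mu>\<^sup>2"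
  have k: "k > 0" using \<mu> by (simp add: k_def)
  have Ah: "Ah = S + (1 / k) *\<^sub>R outer r \<theta>hat"
    using stat k by (simp add: k_def[symmetric] flip: stat)
  have "Ah *v \<theta>hat = S *v \<theta>hat + ((norm \<theta>hat)\<^sup>2 / k) *\<^sub>R r"
    by (subst Ah) (simp add: matrix_vector_mult_add_rdistrib scaleR_matrix_vector_assoc[symmetric] outer_mult_vec power2_norm_eq_inner)
  hence "Z - S *v \<theta>hat = (1 + (norm \<theta>hat)\<^sup>2 / k) *\<^sub>R r"
    by (simp add: r_def algebra_simps)
  hence "outer (Z - S *v \<theta>hat) \<theta>hat = (1 + (norm \<theta>hat)\<^sup>2 / k) *\<^sub>R outer r \<theta>hat"
    by (simp add: outer_def vec_eq_iff)
  moreover have "1 / (k + (norm \<theta>hat)\<^sup>2) * (1 + (norm \<theta>hat)\<^sup>2 / k) = 1 / k"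
    using k add_pos_nonneg[OF k, of "(norm \<theta>hat)\<^sup>2"] by (simp add: field_simps)
  ultimately show "Ah = operator_step Z S \<mu> \<theta>hat"
    unfolding operator_step_def k_def[symmetric] by (subst Ah) simp
qed

lemma matrix_inv_apply_solves:
  fixes B :: "real^'d^'d"
  assumes "\<And>x. B *v x = 0 \<Longrightarrow> x = 0"
  shows "B ** matrix_inv B = mat 1"
proof -
  have "invertible B" using assms matrix_left_invertible_ker invertible_left_inverse by blast
  thus ?thesis by (rule matrix_mul_matrix_inv)
qed

lemma mat_mult_vec: "mat c *v x = c *\<^sub>R (x :: real^'d)"
  by (simp add: mat_def matrix_vector_mult_def vec_eq_iff if_distrib[where f="\<lambda>a. a * _"] cong: if_cong)

text \<open>The matrix to be inverted is positive definite, so its inverse is a genuine one and the update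
  satisfies the normal equation.\<close>
lemma ridge_step_solves:
  fixes A :: "real^'d^'d"
  assumes lam: "lam > 0"
    and \<theta>: "\<theta> = matrix_inv (transpose A ** A + mat (2 * lam)) *v (transpose A *v Z)"
  shows "transpose A *v (Z - A *v \<theta>) = (2 * lam) *\<^sub>R \<theta>"
proof -
  let ?B = "transpose A ** A + mat (2 * lam)"
  have B: "?B *v x = transpose A *v (A *v x) + (2 * lam) *\<^sub>R x" for x
    by (simp add: matrix_vector_mult_add_rdistrib matrix_vector_mul_assoc mat_mult_vec)
  have "x = 0" if "?B *v x = 0" for x
  proof -
    have "0 = x \<bullet> (?B *v x)" using that by simp
    also have "\<dots> = (norm (A *v x))\<^sup>2 + 2 * lam * (norm x)\<^sup>2"
      unfolding B inner_add_right inner_mat_transpose by (simp add: power2_norm_eq_inner)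
    finally have "2 * lam * (norm x)\<^sup>2 \<le> 0" using zero_le_power2[of "norm (A *v x)"] by linarith
    thus "x = 0" using lam by (simp add: mult_le_0_iff)
  qed
  hence "?B ** matrix_inv ?B = mat 1" by (rule matrix_inv_apply_solves)
  hence "?B *v \<theta> = transpose A *v Z"
    unfolding \<theta> by (simp only: matrix_vector_mul_assoc matrix_vector_mul_lid matrix_mul_assoc matrix_mul_lid)
  thus ?thesis unfolding B by (simp add: matrix_vector_mult_diff_distrib algebra_simps)
qed

lemma outer_mult_outer: "outer a b ** outer c d = (b \<bullet> c) *\<^sub>R outer a d"
  by (simp add: outer_def matrix_matrix_mult_def inner_vec_def vec_eq_iff sum_distrib_left sum_distrib_right mult_ac)

lemma mult_outer: "B ** outer c d = outer (B *v c) d"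
  by (simp add: outer_def matrix_matrix_mult_def matrix_vector_mult_def vec_eq_iff sum_distrib_left sum_distrib_right mult_ac)

lemma mult_mat_right: "B ** mat c = c *\<^sub>R (B :: real^'d^'d)"
  by (simp add: mat_def matrix_matrix_mult_def vec_eq_iff if_distrib[where f="\<lambda>a. _ * a"] mult.commute cong: if_cong)

lemma matrix_add_rdistrib: "(A + B) ** C = A ** C + B ** (C :: real^'d^'d)"
  by (simp add: matrix_matrix_mult_def vec_eq_iff sum.distrib distrib_right)

text \<open>Both inverses are those of one matrix \<open>P\<close>, up to the factor \<open>2 \<mu>\<^sup>2\<close>. Since \<open>\<theta>\<close> is an eigenvector of
  \<open>P\<close> with eigenvalue \<open>2 \<mu>\<^sup>2 + \<parallel>\<theta>\<parallel>\<^sup>2\<close>, the identity becomes evident after multiplication by \<open>P\<close>.\<close>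
lemma operator_step_closed_form:
  fixes S :: "real^'d^'d"
  assumes \<mu>: "\<mu> > 0"
  shows "outer Z \<theta> ** matrix_inv (mat (2 * \<mu>\<^sup>2) + outer \<theta> \<theta>)
        + S ** matrix_inv (mat 1 + (1 / (2 * \<mu>\<^sup>2)) *\<^sub>R outer \<theta> \<theta>) = operator_step Z S \<mu> \<theta>"
proof -
  define k where "k = 2 * \<mu>\<^sup>2"
  have k: "k > 0" using \<mu> by (simp add: k_def)
  define P where "P = mat k + outer \<theta> \<theta>"
  define Q where "Q = mat 1 + (1 / k) *\<^sub>R outer \<theta> \<theta>"
  have PQ: "P = k *\<^sub>R Q" using k by (simp add: P_def Q_def mat_def vec_eq_iff distrib_left)
  have Px: "P *v x = k *\<^sub>R x + (\<theta> \<bullet> x) *\<^sub>R \<theta>" for x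
    by (simp add: P_def matrix_vector_mult_add_rdistrib mat_mult_vec outer_mult_vec)
  have "x = 0" if "P *v x = 0" for x
  proof -
    have "0 = x \<bullet> (P *v x)" using that by simp
    also have "\<dots> = k * (norm x)\<^sup>2 + (\<theta> \<bullet> x)\<^sup>2"
      unfolding Px power2_norm_eq_inner by (simp add: inner_simps power2_eq_square inner_commute)
    finally have "k * (norm x)\<^sup>2 \<le> 0" using zero_le_power2[of "\<theta> \<bullet> x"] by linarith
    thus "x = 0" using k by (simp add: mult_le_0_iff)
  qed
  hence invP: "P ** matrix_inv P = mat 1" by (rule matrix_inv_apply_solves)
  have "x = 0" if "Q *v x = 0" for x
    using \<open>\<And>x. P *v x = 0 \<Longrightarrow> x = 0\<close>[of x] that by (simp add: PQ scaleR_matrix_vector_assoc[symmetric])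
  hence invQ: "Q ** matrix_inv Q = mat 1" by (rule matrix_inv_apply_solves)
  have QP: "matrix_inv Q = k *\<^sub>R matrix_inv P"
  proof -
    have "P ** matrix_inv Q = k *\<^sub>R mat 1" by (simp add: PQ invQ scalar_matrix_assoc[symmetric])
    also have "\<dots> = P ** (k *\<^sub>R matrix_inv P)" 
      by (simp add: invP matrix_scalar_ac scalar_matrix_assoc[symmetric])
    finally have "matrix_inv P ** (P ** matrix_inv Q) = matrix_inv P ** (P ** (k *\<^sub>R matrix_inv P))" by simp
    moreover have "matrix_inv P ** P = mat 1" using invP matrix_left_right_inverse by blast
    ultimately show ?thesis by (simp add: matrix_mul_assoc)
  qed
  have step: "operator_step Z S \<mu> \<theta> ** P = outer Z \<theta> + k *\<^sub>R S"
  proof -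
    define q where "q = k + (norm \<theta>)\<^sup>2"
    have q: "q > 0" using k by (simp add: q_def add_pos_nonneg)
    have "outer (Z - S *v \<theta>) \<theta> ** P = q *\<^sub>R outer (Z - S *v \<theta>) \<theta>"
      by (simp add: P_def matrix_add_ldistrib mult_mat_right outer_mult_outer q_def power2_norm_eq_inner scaleR_add_left)
    hence "(1 / q) *\<^sub>R outer (Z - S *v \<theta>) \<theta> ** P = outer (Z - S *v \<theta>) \<theta>"
      using q by (simp add: scalar_matrix_assoc[symmetric])
    moreover have "S ** P = k *\<^sub>R S + outer (S *v \<theta>) \<theta>"
      by (simp add: P_def matrix_add_ldistrib mult_mat_right mult_outer)
    moreover have "outer (S *v \<theta>) \<theta> + outer (Z - S *v \<theta>) \<theta> = outer Z \<theta>"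
      by (simp add: outer_def vec_eq_iff algebra_simps)
    ultimately show ?thesis
      unfolding operator_step_def k_def[symmetric] q_def[symmetric] by (simp add: matrix_add_rdistrib)
  qed
  have "operator_step Z S \<mu> \<theta> = operator_step Z S \<mu> \<theta> ** (P ** matrix_inv P)" by (simp add: invP)
  also have "\<dots> = (outer Z \<theta> + k *\<^sub>R S) ** matrix_inv P" by (simp add: matrix_mul_assoc step)
  also have "\<dots> = outer Z \<theta> ** matrix_inv P + S ** matrix_inv Q"
    by (simp add: QP matrix_add_rdistrib matrix_scalar_ac scalar_matrix_assoc[symmetric])
  finally show ?thesis by (simp add: P_def Q_def k_def)
qed

section \<open>Contraction of the alternating minimization\<close>

text \<open>Subtracting the normal equations, with \<open>\<Delta> = \<theta> - \<theta>'\<close>, \<open>H = A - A'\<close> and \<open>r = Z - A' \<theta>'\<close>, gives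
  \<open>2 \<lambda> \<Delta> = A\<^sup>T (r - H \<theta>' - A \<Delta>) - A'\<^sup>T r\<close>. Tested with \<open>\<Delta>\<close>, the term \<open>- \<parallel>A \<Delta>\<parallel>\<^sup>2\<close> absorbs the cross term
  \<open>A \<Delta> \<bullet> H \<theta>'\<close>, so the bound involves \<open>A\<close> only through \<open>H\<close>.\<close>
lemma ridge_perturbation:
  fixes A A' :: "real^'d^'d"
  assumes lam: "lam > 0" and N: "N \<ge> 0"
    and st: "transpose A *v (Z - A *v \<theta>) = (2 * lam) *\<^sub>R \<theta>"
    and st': "transpose A' *v (Z - A' *v \<theta>') = (2 * lam) *\<^sub>R \<theta>'"
    and bound: "1/2 * (norm (Z - A' *v \<theta>'))\<^sup>2 + lam * (norm \<theta>')\<^sup>2 \<le> lam * N\<^sup>2"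
  shows "norm (\<theta> - \<theta>') \<le> norm (A - A') * N / sqrt lam"
proof -
  define \<Delta> where "\<Delta> = \<theta> - \<theta>'"
  define r where "r = Z - A' *v \<theta>'"
  define H where "H = A - A'"
  define L where "L = sqrt lam"
  have L: "L > 0" "lam = L\<^sup>2" using lam by (auto simp: L_def)
  have AH: "A = A' + H" by (simp add: H_def)
  have eq: "(2 * lam) *\<^sub>R \<Delta> = transpose A *v (r - H *v \<theta>' - A *v \<Delta>) - transpose A' *v r"
  proof -
    have "Z - A *v \<theta> = r - H *v \<theta>' - A *v \<Delta>"
      by (simp add: r_def \<Delta>_def AH matrix_vector_mult_add_rdistrib matrix_vector_mult_diff_distrib)
    hence "transpose A *v (r - H *v \<theta>' - A *v \<Delta>) = (2 * lam) *\<^sub>R \<theta>" using st by metis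
    thus ?thesis using st' unfolding r_def[symmetric] by (simp only: \<Delta>_def scaleR_diff_right)
  qed
  have "2 * lam * (norm \<Delta>)\<^sup>2 = \<Delta> \<bullet> ((2 * lam) *\<^sub>R \<Delta>)" by (simp add: power2_norm_eq_inner)
  also have "\<dots> = (A *v \<Delta>) \<bullet> (r - H *v \<theta>' - A *v \<Delta>) - (A' *v \<Delta>) \<bullet> r"
    unfolding eq inner_diff_right inner_mat_transpose by (simp add: inner_simps)
  also have "\<dots> = (H *v \<Delta>) \<bullet> r - (A *v \<Delta>) \<bullet> (H *v \<theta>') - (norm (A *v \<Delta>))\<^sup>2"
    by (simp add: AH matrix_vector_mult_add_rdistrib inner_simps power2_norm_eq_inner)
  also have "\<dots> \<le> norm (H *v \<Delta>) * norm r + (norm (H *v \<theta>') / 2)\<^sup>2"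
  proof -
    have "(H *v \<Delta>) \<bullet> r \<le> norm (H *v \<Delta>) * norm r" by (rule norm_cauchy_schwarz)
    moreover have "- ((A *v \<Delta>) \<bullet> (H *v \<theta>')) \<le> norm (A *v \<Delta>) * norm (H *v \<theta>')"
      using Cauchy_Schwarz_ineq2[of "A *v \<Delta>" "H *v \<theta>'"] by linarith
    moreover have "norm (A *v \<Delta>) * norm (H *v \<theta>') \<le> (norm (A *v \<Delta>))\<^sup>2 + (norm (H *v \<theta>') / 2)\<^sup>2"
      using sum_squares_bound[of "norm (A *v \<Delta>)" "norm (H *v \<theta>') / 2"] by simp
    ultimately show ?thesis by linarith
  qed
  also have "\<dots> \<le> (norm H * norm \<Delta>) * (3/2 * L * N) + (norm H * N / 2)\<^sup>2"
  proof -
    have "(norm r)\<^sup>2 \<le> 2 * lam * N\<^sup>2" 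
      using bound lam mult_nonneg_nonneg[OF _ zero_le_power2, of lam "norm \<theta>'"] unfolding r_def by linarith
    also have "\<dots> \<le> (3/2 * L * N)\<^sup>2" using L N by (simp add: L(2) power_mult_distrib power_divide)
    finally have r: "norm r \<le> 3/2 * L * N" by (rule power2_le_imp_le) (use L N in simp)
    have "lam * (norm \<theta>')\<^sup>2 \<le> lam * N\<^sup>2" 
      using bound zero_le_power2[of "norm (Z - A' *v \<theta>')"] by linarith
    hence th: "norm \<theta>' \<le> N" using lam N by (auto intro: power2_le_imp_le)
    have "norm (H *v \<theta>') \<le> norm H * N"
      using norm_matrix_vector_mult_le[of H \<theta>'] mult_left_mono[OF th, of "norm H"] by simp
    thus ?thesis
      by (intro add_mono mult_mono power_mono norm_matrix_vector_mult_le r) (auto simp: divide_right_mono)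
  qed
  finally have main: "2 * (L * norm \<Delta>)\<^sup>2 \<le> 3/2 * (L * norm \<Delta>) * (norm H * N) + (norm H * N)\<^sup>2 / 4"
    by (simp add: L(2) power_mult_distrib power_divide mult_ac)
  have "D \<le> y" if "2 * D\<^sup>2 \<le> 3/2 * D * y + y\<^sup>2 / 4" "0 \<le> y" for D y :: real
  proof (rule ccontr)
    assume "\<not> ?thesis"
    hence "y\<^sup>2 < D\<^sup>2" "D * y \<le> D\<^sup>2"
      using that(2) by (auto simp: power2_eq_square intro!: mult_strict_mono mult_left_mono)
    thus False using that(1) zero_le_power2[of D] by linarith
  qed
  from this[OF main] have "L * norm \<Delta> \<le> norm H * N" using N by simp
  thus ?thesis using L unfolding L_def \<Delta>_def H_def by (simp add: field_simps)
qed

text \<open>The correction is the product of a residual, of \<open>\<theta>\<close> and of the scalar \<open>1 / (2 \<mu>\<^sup>2 + \<parallel>\<theta>\<parallel>\<^sup>2)\<close>; these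
  are exchanged one at a time. The smallness of \<open>N\<close> relative to \<open>\<mu>\<close> is what bounds the change of the
  scalar by the change of \<open>\<theta>\<close>.\<close>
lemma operator_step_lipschitz:
  fixes Z :: "real^'d"
  assumes \<mu>: "\<mu> > 0" and N: "0 \<le> N" "3 * N\<^sup>2 \<le> 2 * \<mu>\<^sup>2"
    and m: "0 \<le> m" "\<And>x. norm (S *v x) \<le> m * norm x"
    and p: "norm (Z - S *v \<theta>') \<le> p"
    and th: "norm \<theta> \<le> 2 * N" "norm \<theta>' \<le> N"
  shows "norm (operator_step Z S \<mu> \<theta> - operator_step Z S \<mu> \<theta>') \<le> (m * N + p) / \<mu>\<^sup>2 * norm (\<theta> - \<theta>')"
proof -
  define k where "k = 2 * \<mu>\<^sup>2"
  define q where "q = k + (norm \<theta>)\<^sup>2"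
  define q' where "q' = k + (norm \<theta>')\<^sup>2"
  define r where "r = Z - S *v \<theta>"
  define r' where "r' = Z - S *v \<theta>'"
  define \<Delta> where "\<Delta> = \<theta> - \<theta>'"
  have k: "k > 0" using \<mu> by (simp add: k_def)
  have q: "q \<ge> k" "q' \<ge> k" by (auto simp: q_def q'_def)
  have p0: "p \<ge> 0" using p norm_ge_zero order_trans by blast
  have "operator_step Z S \<mu> \<theta> - operator_step Z S \<mu> \<theta>' =
     (1/q) *\<^sub>R outer (r - r') \<theta> + (1/q) *\<^sub>R outer r' \<Delta> + (1/q - 1/q') *\<^sub>R outer r' \<theta>'"
    unfolding operator_step_def k_def[symmetric] q_def[symmetric] q'_def[symmetric] r_def[symmetric] r'_def[symmetric] \<Delta>_def
    by (simp add: outer_def vec_eq_iff algebra_simps)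
  also have "norm \<dots> \<le> norm ((1/q) *\<^sub>R outer (r - r') \<theta>) + norm ((1/q) *\<^sub>R outer r' \<Delta>) + norm ((1/q - 1/q') *\<^sub>R outer r' \<theta>')"
    by (rule order_trans[OF norm_triangle_ineq add_right_mono[OF norm_triangle_ineq]])
  also have "norm ((1/q) *\<^sub>R outer (r - r') \<theta>) \<le> (1/k) * ((m * norm \<Delta>) * (2 * N))"
  proof -
    have "r - r' = - (S *v \<Delta>)" by (simp add: r_def r'_def \<Delta>_def matrix_vector_mult_diff_distrib)
    hence "norm (r - r') \<le> m * norm \<Delta>" using m(2)[of \<Delta>] by simp
    moreover have "\<bar>1/q\<bar> \<le> 1/k" using q k by (simp add: frac_le)
    ultimately show ?thesis unfolding norm_scaleR norm_outer using th m(1) k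
      by (intro mult_mono) auto
  qed
  also have "norm ((1/q) *\<^sub>R outer r' \<Delta>) \<le> (1/k) * (p * norm \<Delta>)"
  proof -
    have "\<bar>1/q\<bar> \<le> 1/k" using q k by (simp add: frac_le)
    thus ?thesis unfolding norm_scaleR norm_outer using p p0 k unfolding r'_def
      by (intro mult_mono) auto
  qed
  also have "norm ((1/q - 1/q') *\<^sub>R outer r' \<theta>') \<le> ((3 * N * norm \<Delta>) / (k * k)) * (p * N)"
  proof -
    have "1/q - 1/q' = (q' - q) / (q * q')" using q k by (simp add: field_simps)
    moreover have "\<bar>q' - q\<bar> \<le> 3 * N * norm \<Delta>"
    proof -
      have "q' - q = (norm \<theta>' - norm \<theta>) * (norm \<theta>' + norm \<theta>)"
        by (simp add: q_def q'_def power2_eq_square algebra_simps)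
      moreover have "\<bar>norm \<theta>' - norm \<theta>\<bar> \<le> norm \<Delta>"
        unfolding \<Delta>_def by (metis norm_minus_commute norm_triangle_ineq3)
      ultimately show ?thesis using th mult_mono[of "\<bar>norm \<theta>' - norm \<theta>\<bar>" "norm \<Delta>" "\<bar>norm \<theta>' + norm \<theta>\<bar>" "3 * N"]
        by (simp add: abs_mult mult.commute)
    qed
    moreover have "k * k \<le> q * q'" using q k by (intro mult_mono) auto
    ultimately have "\<bar>1/q - 1/q'\<bar> \<le> (3 * N * norm \<Delta>) / (k * k)"
      using k q by (simp only: abs_divide) (intro frac_le; simp add: abs_mult)
    thus ?thesis unfolding norm_scaleR norm_outer using p p0 k th N unfolding r'_def
      by (intro mult_mono) auto
  qed
  also have "((3 * N * norm \<Delta>) / (k * k)) * (p * N) \<le> (1/k) * (p * norm \<Delta>)"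
  proof -
    have "((3 * N * norm \<Delta>) / (k * k)) * (p * N) = (3 * N\<^sup>2 / k) * ((1/k) * (p * norm \<Delta>))"
      by (simp add: power2_eq_square)
    also have "\<dots> \<le> 1 * ((1/k) * (p * norm \<Delta>))"
      using N(2) k p0 by (intro mult_right_mono) (auto simp: k_def[symmetric])
    finally show ?thesis by simp
  qed
  finally have "norm (operator_step Z S \<mu> \<theta> - operator_step Z S \<mu> \<theta>') \<le> (2 / k) * (m * N + p) * norm \<Delta>"
    by (simp add: algebra_simps add_divide_distrib)
  thus ?thesis unfolding k_def \<Delta>_def by simp
qed

text \<open>Here \<open>\<theta>0\<close> is an arbitrary comparison vector: the energy of \<open>(\<theta>0, S)\<close> bounds that of the minimiser
  by \<open>\<lambda> N\<^sup>2\<close>. The two Lipschitz constants multiply to \<open>(\<rho> \<surd>\<lambda> / \<mu>) (\<rho> \<mu> / 6) / \<surd>\<lambda> = \<rho>\<^sup>2 / 6\<close>. By the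
  contraction itself, the iterates stay within \<open>N\<close> of \<open>\<theta>hat\<close>, hence in the ball of radius \<open>2 N\<close> where the
  Lipschitz bound holds.\<close>
lemma alternating_minimization_contraction:
  fixes Z \<theta>0 \<theta>hat :: "real^'d" and S :: "real^'d^'d" and \<theta> :: "nat \<Rightarrow> real^'d" and A :: "nat \<Rightarrow> real^'d^'d"
  assumes pos: "\<mu> > 0" "lam > 0" and \<rho>: "0 < \<rho>" "\<rho> \<le> 1"
    and m: "0 \<le> m" "\<And>x. norm (S *v x) \<le> m * norm x"
    and N: "N = norm \<theta>0 + norm (Z - S *v \<theta>0) / sqrt lam"
    and N1: "N \<le> \<rho> * \<mu> / 6" and N2: "5 * m * N + norm (Z - S *v \<theta>0) \<le> \<rho> * \<mu> * sqrt lam"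
    and min: "is_arg_min (objective Z S \<mu> lam) (\<lambda>_. True) (\<theta>hat, \<eta>h, Ah)"
    and A0: "A 0 = S"
    and \<theta>: "\<And>t. t \<in> {1..T} \<Longrightarrow> \<theta> t = matrix_inv (transpose (A (t - 1)) ** A (t - 1) + mat (2 * lam))
        *v (transpose (A (t - 1)) *v Z)"
    and A: "\<And>t. t \<in> {1..T} \<Longrightarrow>
      A t = outer Z (\<theta> t) ** matrix_inv (mat (2 * \<mu>\<^sup>2) + outer (\<theta> t) (\<theta> t))
        + S ** matrix_inv (mat 1 + (1 / (2 * \<mu>\<^sup>2)) *\<^sub>R outer (\<theta> t) (\<theta> t))"
    and T: "T \<ge> 1"
  shows "norm (\<theta> T - \<theta>hat) \<le> \<rho> ^ (2 * T) * (N / 6)"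
proof -
  define z where "z = norm (Z - S *v \<theta>0)"
  define L where "L = sqrt lam"
  have L: "L > 0" "lam = L\<^sup>2" using pos by (auto simp: L_def)
  have N0: "0 \<le> N" unfolding N using pos by simp
  have zL: "norm \<theta>0 * L + z = L * N" using L unfolding N z_def[symmetric] L_def[symmetric] by (simp add: field_simps)
  have energy: "1/2 * (norm (Z - Ah *v \<theta>hat))\<^sup>2 + lam * (norm \<theta>hat)\<^sup>2 \<le> lam * N\<^sup>2"
  proof -
    have "0 \<le> \<mu>\<^sup>2 * (norm (S - Ah))\<^sup>2" by (intro mult_nonneg_nonneg zero_le_power2)
    moreover have "\<mu>\<^sup>2 * (norm (S - S))\<^sup>2 = 0" by simp
    ultimately have "1/2 * (norm (Z - Ah *v \<theta>hat))\<^sup>2 + lam * (norm \<theta>hat)\<^sup>2 \<le> 1/2 * z\<^sup>2 + lam * (norm \<theta>0)\<^sup>2"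
      using is_arg_min_objective_residual[OF min, of S \<theta>0] unfolding z_def by linarith
    also have "\<dots> \<le> (norm \<theta>0 * L + z)\<^sup>2"
      using L by (simp add: power2_sum power_mult_distrib z_def)
    finally show ?thesis unfolding zL by (simp add: L(2) power_mult_distrib)
  qed
  have thN: "norm \<theta>hat \<le> N"
  proof -
    have "lam * (norm \<theta>hat)\<^sup>2 \<le> lam * N\<^sup>2"
      using energy zero_le_power2[of "norm (Z - Ah *v \<theta>hat)"] by linarith
    thus ?thesis using pos N0 by (auto intro: power2_le_imp_le)
  qed
  note stat = is_arg_min_stationary[OF min pos(1)]
  have p: "norm (Z - S *v \<theta>hat) \<le> z + 2 * m * N"
  proof -
    have "Z - S *v \<theta>hat = (Z - S *v \<theta>0) + S *v (\<theta>0 - \<theta>hat)" by (simp add: matrix_vector_mult_diff_distrib)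
    hence "norm (Z - S *v \<theta>hat) \<le> z + m * norm (\<theta>0 - \<theta>hat)"
      unfolding z_def using m(2)[of "\<theta>0 - \<theta>hat"] norm_triangle_mono[OF order_refl, of "S *v (\<theta>0 - \<theta>hat)"] by metis
    moreover have "norm (\<theta>0 - \<theta>hat) \<le> 2 * N"
    proof -
      have "norm \<theta>0 \<le> N" unfolding N using pos by simp
      thus ?thesis using thN norm_triangle_ineq4[of \<theta>0 \<theta>hat] by linarith
    qed
    ultimately show ?thesis using mult_left_mono[of "norm (\<theta>0 - \<theta>hat)" "2 * N" m] m(1) by simp
  qed
  have contr: "norm (\<theta>1 - \<theta>hat) \<le> \<rho>\<^sup>2 / 6 * norm (\<theta>' - \<theta>hat)"
    if small: "norm \<theta>' \<le> 2 * N" and B: "B = operator_step Z S \<mu> \<theta>'"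
      and st: "transpose B *v (Z - B *v \<theta>1) = (2 * lam) *\<^sub>R \<theta>1" for \<theta>' \<theta>1 B
  proof -
    have N\<mu>: "3 * N\<^sup>2 \<le> 2 * \<mu>\<^sup>2"
    proof -
      have "N \<le> \<mu> / 6" using N1 \<rho> pos mult_right_mono[of \<rho> 1 \<mu>] by linarith
      hence "N\<^sup>2 \<le> (\<mu> / 6)\<^sup>2" using N0 by (intro power_mono)
      hence "N\<^sup>2 \<le> \<mu>\<^sup>2 / 36" by (simp add: power_divide)
      thus ?thesis using zero_le_power2[of \<mu>] by linarith
    qed
    have "norm (B - Ah) \<le> (m * N + (z + 2 * m * N)) / \<mu>\<^sup>2 * norm (\<theta>' - \<theta>hat)"
      unfolding B stat(2) by (rule operator_step_lipschitz[OF pos(1) N0 N\<mu> m p small thN])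
    also have "\<dots> \<le> (\<rho> * \<mu> * L) / \<mu>\<^sup>2 * norm (\<theta>' - \<theta>hat)"
    proof -
      have "0 \<le> m * N" using m N0 by simp
      hence "m * N + (z + 2 * m * N) \<le> \<rho> * \<mu> * L" using N2 unfolding z_def L_def by linarith
      thus ?thesis by (intro mult_right_mono divide_right_mono) auto
    qed
    also have "\<dots> = (\<rho> * L / \<mu>) * norm (\<theta>' - \<theta>hat)" using pos by (simp add: power2_eq_square)
    finally have e: "norm (B - Ah) \<le> (\<rho> * L / \<mu>) * norm (\<theta>' - \<theta>hat)" .
    have "norm (\<theta>1 - \<theta>hat) \<le> norm (B - Ah) * N / sqrt lam"
      by (rule ridge_perturbation[OF pos(2) N0 st stat(1) energy])
    also have "\<dots> \<le> ((\<rho> * L / \<mu>) * norm (\<theta>' - \<theta>hat)) * (\<rho> * \<mu> / 6) / sqrt lam"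
      using e N0 N1 pos \<rho> L by (intro divide_right_mono mult_mono) auto
    also have "\<dots> = \<rho>\<^sup>2 / 6 * norm (\<theta>' - \<theta>hat)"
      using pos L unfolding L_def[symmetric] by (simp add: power2_eq_square)
    finally show ?thesis .
  qed
  have stepA: "A t = operator_step Z S \<mu> (\<theta> t)" if "t \<in> {1..T}" for t
    using A[OF that] operator_step_closed_form[OF pos(1)] by metis
  have "norm (\<theta> t - \<theta>hat) \<le> \<rho> ^ (2 * t) * (N / 6)" if "t \<ge> 1" "t \<le> T" for t
    using that
  proof (induction t rule: nat_induct_at_least)
    case base
    \<comment> \<open>The iteration behaves as if it had started from \<open>\<theta> = 0\<close>.\<close>
    have "A 0 = operator_step Z S \<mu> 0" by (simp add: A0 operator_step_def outer_def vec_eq_iff)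
    from contr[OF _ this ridge_step_solves[OF pos(2)], of "\<theta> 1"] \<theta>[of 1] T N0
    have "norm (\<theta> 1 - \<theta>hat) \<le> \<rho>\<^sup>2 / 6 * norm (0 - \<theta>hat)" by simp
    also have "\<dots> \<le> \<rho>\<^sup>2 / 6 * N" using thN by (intro mult_left_mono) auto
    finally show ?case by simp
  next
    case (Suc t)
    hence t: "t \<in> {1..T}" "Suc t \<in> {1..T}" and IH: "norm (\<theta> t - \<theta>hat) \<le> \<rho> ^ (2 * t) * (N / 6)" by auto
    have "\<rho> ^ (2 * t) * (N / 6) \<le> 1 * (N / 6)" using \<rho> N0 by (intro mult_right_mono power_le_one) auto
    hence "norm (\<theta> t) \<le> 2 * N" using IH thN N0 norm_triangle_sub[of "\<theta> t" \<theta>hat] by linarith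
    from contr[OF this stepA[OF t(1)] ridge_step_solves[OF pos(2)], of "\<theta> (Suc t)"] \<theta>[OF t(2)]
    have "norm (\<theta> (Suc t) - \<theta>hat) \<le> \<rho>\<^sup>2 / 6 * norm (\<theta> t - \<theta>hat)" by simp
    also have "\<dots> \<le> \<rho>\<^sup>2 * (\<rho> ^ (2 * t) * (N / 6))" using IH by (intro mult_mono) auto
    finally show ?case by (simp add: power2_eq_square)
  qed
  thus ?thesis using T by simp
qed

section \<open>Gaussian smoothing of convex functions\<close>

definition gauss_density :: "real^'d \<Rightarrow> real" where
  "gauss_density x = (1 / sqrt (2 * pi)) ^ CARD('d) * exp (- (norm x)\<^sup>2 / 2)"

lemma gauss_density_measurable [measurable]: "gauss_density \<in> borel_measurable borel"
  unfolding gauss_density_def by measurable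

lemma gauss_density_pos: "gauss_density x > 0"
  unfolding gauss_density_def by (simp add: pi_gt_zero)

lemma gauss_density_uminus: "gauss_density (- x) = gauss_density x"
  by (simp add: gauss_density_def)

lemma gauss_density_shift: "gauss_density (y + h) = gauss_density y * exp (- (h \<bullet> y) - (norm h)\<^sup>2 / 2)"
proof -
  have "- (norm (y + h))\<^sup>2 / 2 = - (norm y)\<^sup>2 / 2 + (- (h \<bullet> y) - (norm h)\<^sup>2 / 2)"
    using power2_norm_add_scaleR[of y 1 h] by (simp add: inner_commute field_simps)
  thus ?thesis unfolding gauss_density_def by (simp only: exp_add mult.assoc)
qed

lemma nn_integral_gauss_density: "(\<integral>\<^sup>+x. gauss_density (x :: real^'d) \<partial>lborel) = 1"
proof -
  have "gauss_density x = (\<Prod>b\<in>Basis. std_normal_density (x \<bullet> b))" for x :: "real^'d"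
  proof -
    have "(\<Sum>b\<in>Basis. (x \<bullet> b)\<^sup>2) = (norm x)\<^sup>2"
      unfolding power2_norm_eq_inner by (subst euclidean_inner) (simp add: power2_eq_square)
    hence "(\<Sum>b\<in>Basis. - (x \<bullet> b)\<^sup>2 / 2) = - (norm x)\<^sup>2 / 2"
      by (simp add: sum_negf sum_divide_distrib[symmetric])
    hence "exp (- (norm x)\<^sup>2 / 2) = (\<Prod>b\<in>Basis. exp (- (x \<bullet> b)\<^sup>2 / 2))"
      by (metis exp_sum finite_Basis)
    moreover have "(\<Prod>b\<in>(Basis :: (real^'d) set). 1 / sqrt (2 * pi)) = (1 / sqrt (2 * pi)) ^ CARD('d)"
      by simp
    ultimately show ?thesis
      unfolding gauss_density_def std_normal_density_def prod.distrib by simp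
  qed
  hence "(\<integral>\<^sup>+x. gauss_density (x :: real^'d) \<partial>lborel)
      = (\<integral>\<^sup>+x. (\<Prod>b\<in>Basis. ennreal (std_normal_density (x \<bullet> b))) \<partial>(lborel :: (real^'d) measure))"
    by (simp add: prod_ennreal)
  also have "\<dots> = (\<Prod>b\<in>(Basis :: (real^'d) set). (\<integral>\<^sup>+x. ennreal (std_normal_density x) \<partial>lborel))"
    by (rule nn_integral_lborel_prod) auto
  also have "(\<integral>\<^sup>+x. ennreal (std_normal_density x) \<partial>lborel) = 1"
    using prob_space.emeasure_space_1[OF prob_space_normal_density[of 1 0]] by (simp add: emeasure_density)
  finally show ?thesis by simp
qed

lemma nn_integral_lborel_uminus:
  fixes f :: "real^'d \<Rightarrow> ennreal"
  assumes [measurable]: "f \<in> borel_measurable borel"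
  shows "(\<integral>\<^sup>+x. f (- x) \<partial>lborel) = (\<integral>\<^sup>+x. f x \<partial>lborel)"
proof -
  have "(lborel :: (real^'d) measure) = density (distr lborel borel uminus) (\<lambda>_. 1)"
    using lborel_affine[of "-1" "0 :: real^'d"] by simp
  hence "(\<integral>\<^sup>+x. f x \<partial>lborel) = (\<integral>\<^sup>+x. f x \<partial>density (distr lborel borel uminus) (\<lambda>_. 1))" by simp
  also have "\<dots> = (\<integral>\<^sup>+x. f (- x) \<partial>lborel)"
    by (simp add: density_1 nn_integral_distr)
  finally show ?thesis by simp
qed

lemma nn_integral_lborel_shift:
  fixes f :: "real^'d \<Rightarrow> ennreal"
  assumes [measurable]: "f \<in> borel_measurable borel"
  shows "(\<integral>\<^sup>+x. f (x + h) \<partial>lborel) = (\<integral>\<^sup>+x. f x \<partial>lborel)"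
proof -
  have "(\<integral>\<^sup>+x. f x \<partial>lborel) = (\<integral>\<^sup>+x. f x \<partial>distr lborel borel ((+) h))"
    by (simp add: lborel_distr_plus)
  also have "\<dots> = (\<integral>\<^sup>+x. f (h + x) \<partial>lborel)" by (simp add: nn_integral_distr)
  finally show ?thesis by (simp add: add.commute)
qed

text \<open>Lebesgue measure is invariant under \<open>x \<mapsto> - x\<close>, so it suffices to dominate \<open>g\<close> by the even part
  of \<open>f\<close>.\<close>
lemma nn_integral_symmetrize:
  fixes f :: "real^'d \<Rightarrow> ennreal"
  assumes [measurable]: "f \<in> borel_measurable borel" "g \<in> borel_measurable borel"
    and le: "\<And>x. 2 * g x \<le> f x + f (- x)"
  shows "(\<integral>\<^sup>+x. g x \<partial>lborel) \<le> (\<integral>\<^sup>+x. f x \<partial>lborel)"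
proof -
  have "2 * (\<integral>\<^sup>+x. g x \<partial>lborel) = (\<integral>\<^sup>+x. 2 * g x \<partial>lborel)"
    by (simp add: nn_integral_cmult)
  also have "\<dots> \<le> (\<integral>\<^sup>+x. f x + f (- x) \<partial>lborel)"
    by (intro nn_integral_mono le)
  also have "\<dots> = 2 * (\<integral>\<^sup>+x. f x \<partial>lborel)"
    by (simp add: nn_integral_add nn_integral_lborel_uminus mult_2)
  finally have "(1/2) * (2 * (\<integral>\<^sup>+x. g x \<partial>lborel)) \<le> (1/2) * (2 * (\<integral>\<^sup>+x. f x \<partial>lborel))"
    by (rule mult_left_mono) simp
  thus ?thesis by (simp add: mult.assoc[symmetric] ennreal_divide_times ennreal_times_divide)
qed

lemma exp_sum_ge_1_plus_square: "2 + (a::real)\<^sup>2 \<le> exp a + exp (- a)"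
proof -
  have "2 + a\<^sup>2 \<le> exp a + exp (- a)" if "a \<ge> 0" for a :: real
  proof -
    define f where "f x = exp x + exp (- x) - 2 - x\<^sup>2" for x :: real
    have s: "exp x - exp (- x) - 2 * x \<ge> 0" if "x \<ge> 0" for x :: real
    proof -
      have "exp 0 - exp (- 0) - 2 * 0 \<le> exp x - exp (- x) - 2 * x"
      proof (rule DERIV_nonneg_imp_nondecreasing[OF that])
        fix y :: real assume "0 \<le> y"
        have "((\<lambda>x. exp x - exp (- x) - 2 * x) has_real_derivative exp y + exp (- y) - 2) (at y)"
          by (auto intro!: derivative_eq_intros)
        moreover have "exp y + exp (- y) - 2 \<ge> 0"
          using exp_ge_add_one_self[of y] exp_ge_add_one_self[of "-y"] by linarith
        ultimately show "\<exists>D. ((\<lambda>x. exp x - exp (- x) - 2 * x) has_real_derivative D) (at y) \<and> 0 \<le> D" by blast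
      qed
      thus ?thesis by simp
    qed
    have "f 0 \<le> f a"
    proof (rule DERIV_nonneg_imp_nondecreasing[OF that])
      fix y :: real assume "0 \<le> y"
      have "(f has_real_derivative exp y - exp (- y) - 2 * y) (at y)"
        unfolding f_def by (auto intro!: derivative_eq_intros)
      thus "\<exists>D. (f has_real_derivative D) (at y) \<and> 0 \<le> D" using s[OF \<open>0 \<le> y\<close>] by blast
    qed
    thus ?thesis by (simp add: f_def)
  qed
  from this[of a] this[of "-a"] show ?thesis by (cases "a \<ge> 0") auto
qed

text \<open>Translation invariance replaces a computation in coordinates: the integral of \<open>exp (- (h \<bullet> x))\<close> is
  \<open>exp (1/2)\<close>, and the even part of this exponential dominates \<open>1 + (h \<bullet> x)\<^sup>2 / 2\<close>. The true value is \<open>1\<close>;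
  the loss of a factor 2 is harmless.\<close>
lemma gauss_second_moment_unit:
  assumes h: "norm (h :: real^'d) = 1"
  shows "(\<integral>\<^sup>+x. ennreal ((h \<bullet> x)\<^sup>2) * gauss_density x \<partial>lborel) \<le> 2"
proof -
  have "1 + (\<integral>\<^sup>+x. ennreal ((h \<bullet> x)\<^sup>2 / 2) * gauss_density x \<partial>lborel)
    = (\<integral>\<^sup>+x. ennreal (1 + (h \<bullet> x)\<^sup>2 / 2) * gauss_density x \<partial>lborel)"
    by (simp add: distrib_right nn_integral_add nn_integral_gauss_density)
  also have "\<dots> \<le> (\<integral>\<^sup>+x. ennreal (exp (- (h \<bullet> x))) * gauss_density x \<partial>lborel)"
  proof (rule nn_integral_symmetrize)
    fix x
    have "2 * (1 + (h \<bullet> x)\<^sup>2 / 2) * gauss_density x \<le> (exp (- (h \<bullet> x)) + exp (h \<bullet> x)) * gauss_density x"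
      using exp_sum_ge_1_plus_square[of "h \<bullet> x"] gauss_density_pos[of x]
      by (intro mult_right_mono) auto
    thus "2 * (ennreal (1 + (h \<bullet> x)\<^sup>2 / 2) * ennreal (gauss_density x))
      \<le> ennreal (exp (- (h \<bullet> x))) * ennreal (gauss_density x) + ennreal (exp (- (h \<bullet> - x))) * ennreal (gauss_density (- x))"
      using gauss_density_pos[of x]
      by (simp add: ennreal_mult'[symmetric] ennreal_plus[symmetric] gauss_density_uminus distrib_right mult.assoc
           ennreal_numeral[symmetric] del: ennreal_plus ennreal_numeral)
  qed measurable
  also have "\<dots> = (\<integral>\<^sup>+x. ennreal (exp (1/2)) * ennreal (gauss_density (x + h)) \<partial>lborel)"
  proof (intro nn_integral_cong)
    fix x
    have "exp (- (h \<bullet> x)) * gauss_density x = exp (1/2) * gauss_density (x + h)"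
      unfolding gauss_density_shift h by (simp add: mult.left_commute[of "exp (1/2)"] exp_add[symmetric])
    thus "ennreal (exp (- (h \<bullet> x))) * ennreal (gauss_density x) = ennreal (exp (1/2)) * ennreal (gauss_density (x + h))"
      using gauss_density_pos[of x] by (simp add: ennreal_mult'[symmetric])
  qed
  also have "\<dots> = ennreal (exp (1/2))"
    by (simp add: nn_integral_cmult nn_integral_lborel_shift[where f="\<lambda>x. ennreal (gauss_density x)"] nn_integral_gauss_density)
  also have "\<dots> \<le> 2"
  proof -
    have "exp (1/2 :: real) \<le> 2" by (rule exp_half_le2)
    thus ?thesis by (metis ennreal_leI ennreal_numeral zero_le_numeral)
  qed
  finally have "1 + (\<integral>\<^sup>+x. ennreal ((h \<bullet> x)\<^sup>2 / 2) * gauss_density x \<partial>lborel) \<le> 1 + 1"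
    by simp
  hence "(\<integral>\<^sup>+x. ennreal ((h \<bullet> x)\<^sup>2 / 2) * gauss_density x \<partial>lborel) \<le> 1"
    unfolding ennreal_add_left_cancel_le by simp
  hence "2 * (\<integral>\<^sup>+x. ennreal ((h \<bullet> x)\<^sup>2 / 2) * gauss_density x \<partial>lborel) \<le> 2 * 1"
    by (rule mult_left_mono) simp
  moreover have "2 * (\<integral>\<^sup>+x. ennreal ((h \<bullet> x)\<^sup>2 / 2) * gauss_density x \<partial>lborel)
     = (\<integral>\<^sup>+x. ennreal ((h \<bullet> x)\<^sup>2) * gauss_density x \<partial>lborel)"
    by (simp add: nn_integral_cmult[symmetric] mult.assoc[symmetric] ennreal_mult'[symmetric] ennreal_numeral[symmetric] del: ennreal_numeral)
  ultimately show ?thesis by simp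
qed

lemma gauss_second_moment:
  "(\<integral>\<^sup>+x. ennreal ((v \<bullet> (x :: real^'d))\<^sup>2) * gauss_density x \<partial>lborel) \<le> ennreal (2 * (norm v)\<^sup>2)"
proof (cases "v = 0")
  case False
  define h where "h = v /\<^sub>R norm v"
  have h: "norm h = 1" using False by (simp add: h_def)
  have v: "v = norm v *\<^sub>R h" using False by (simp add: h_def)
  have "(\<integral>\<^sup>+x. ennreal ((v \<bullet> x)\<^sup>2) * gauss_density x \<partial>lborel)
     = (\<integral>\<^sup>+x. ennreal ((norm v)\<^sup>2) * (ennreal ((h \<bullet> x)\<^sup>2) * gauss_density x) \<partial>lborel)"
    by (intro nn_integral_cong, subst v) (simp add: power_mult_distrib ennreal_mult mult.assoc)
  also have "\<dots> \<le> ennreal ((norm v)\<^sup>2) * 2"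
    by (subst nn_integral_cmult) (auto intro!: mult_left_mono gauss_second_moment_unit[OF h])
  also have "\<dots> = ennreal (2 * (norm v)\<^sup>2)" by (simp add: ennreal_mult mult.commute)
  finally show ?thesis .
qed simp

text \<open>Markov's inequality for \<open>\<parallel>R x\<parallel>\<^sup>2\<close>, whose mean is at most twice the squared Frobenius norm of \<open>R\<close>.\<close>
lemma gauss_matrix_ball_mass:
  fixes R :: "real^'d^'d"
  assumes "R \<noteq> 0"
  shows "ennreal (1/2) \<le> (\<integral>\<^sup>+x. indicator {x. norm (R *v x) \<le> 2 * norm R} x * ennreal (gauss_density x) \<partial>lborel)"
proof -
  let ?G = "{x. norm (R *v x) \<le> 2 * norm R}"
  have [measurable]: "(\<lambda>x. R *v x) \<in> borel_measurable borel"
    by (intro borel_measurable_continuous_onI linear_continuous_on matrix_vector_mul_bounded_linear)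
  have nR: "norm R > 0" using assms by simp
  have sq: "(norm (R *v x))\<^sup>2 = (\<Sum>i\<in>UNIV. (R $ i \<bullet> x)\<^sup>2)" for x
    by (simp add: norm_vec_def L2_set_def sum_nonneg matrix_vector_mult_def inner_vec_def)
  have "(\<integral>\<^sup>+x. ennreal ((norm (R *v x))\<^sup>2) * gauss_density x \<partial>lborel)
      = (\<Sum>i\<in>UNIV. (\<integral>\<^sup>+x. ennreal ((R $ i \<bullet> x)\<^sup>2) * gauss_density x \<partial>lborel))"
  proof -
    have "ennreal ((norm (R *v x))\<^sup>2) * gauss_density x = (\<Sum>i\<in>UNIV. ennreal ((R $ i \<bullet> x)\<^sup>2) * gauss_density x)" for x
      unfolding sq by (subst sum_ennreal[symmetric]) (simp_all only: sum_distrib_right zero_le_power2)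
    thus ?thesis by (simp add: nn_integral_sum)
  qed
  also have "\<dots> \<le> (\<Sum>i\<in>UNIV. ennreal (2 * (norm (R $ i))\<^sup>2))"
    by (intro sum_mono gauss_second_moment)
  also have "\<dots> = ennreal (2 * (norm R)\<^sup>2)"
    by (subst sum_ennreal) (auto simp: norm_vec_def[of R] L2_set_def sum_nonneg sum_distrib_left)
  finally have mom: "(\<integral>\<^sup>+x. ennreal ((norm (R *v x))\<^sup>2) * gauss_density x \<partial>lborel) \<le> ennreal (2 * (norm R)\<^sup>2)" .
  have "1 = (\<integral>\<^sup>+x. gauss_density (x :: real^'d) \<partial>lborel)" by (simp add: nn_integral_gauss_density)
  also have "\<dots> \<le> (\<integral>\<^sup>+x. indicator ?G x * ennreal (gauss_density x)
      + ennreal (1 / (4 * (norm R)\<^sup>2)) * (ennreal ((norm (R *v x))\<^sup>2) * gauss_density x) \<partial>lborel)"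
  proof (intro nn_integral_mono)
    fix x
    show "ennreal (gauss_density x) \<le> indicator ?G x * ennreal (gauss_density x)
      + ennreal (1 / (4 * (norm R)\<^sup>2)) * (ennreal ((norm (R *v x))\<^sup>2) * gauss_density x)"
    proof (cases "x \<in> ?G")
      case False
      hence "(2 * norm R)\<^sup>2 \<le> (norm (R *v x))\<^sup>2" by (intro power_mono) auto
      hence "1 \<le> 1 / (4 * (norm R)\<^sup>2) * (norm (R *v x))\<^sup>2" using nR by (simp add: power_mult_distrib)
      hence "1 * gauss_density x \<le> 1 / (4 * (norm R)\<^sup>2) * (norm (R *v x))\<^sup>2 * gauss_density x"
        using gauss_density_pos[of x] by (intro mult_right_mono) auto
      thus ?thesis using False gauss_density_pos[of x]
        by (simp add: ennreal_mult'[symmetric] ennreal_leI mult.assoc)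
    qed simp
  qed
  also have "\<dots> = (\<integral>\<^sup>+x. indicator ?G x * ennreal (gauss_density x) \<partial>lborel)
      + ennreal (1 / (4 * (norm R)\<^sup>2)) * (\<integral>\<^sup>+x. ennreal ((norm (R *v x))\<^sup>2) * gauss_density x \<partial>lborel)"
    by (subst nn_integral_add) (auto simp: nn_integral_cmult)
  also have "\<dots> \<le> (\<integral>\<^sup>+x. indicator ?G x * ennreal (gauss_density x) \<partial>lborel) + ennreal (1 / (4 * (norm R)\<^sup>2)) * ennreal (2 * (norm R)\<^sup>2)"
    by (intro add_left_mono mult_left_mono mom) simp
  also have "ennreal (1 / (4 * (norm R)\<^sup>2)) * ennreal (2 * (norm R)\<^sup>2) = ennreal (1/2)"
    using nR by (simp add: ennreal_mult'[symmetric])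
  also have "(\<integral>\<^sup>+x. indicator ?G x * ennreal (gauss_density x) \<partial>lborel) + ennreal (1/2)
      = ennreal (1/2) + (\<integral>\<^sup>+x. indicator ?G x * ennreal (gauss_density x) \<partial>lborel)" by (rule add.commute)
  also have "1 = ennreal (1/2) + ennreal (1/2)" by (subst ennreal_plus[symmetric]) simp_all
  finally show ?thesis unfolding ennreal_add_left_cancel_le by simp
qed

text \<open>The point value of \<open>exp F\<close> at \<open>h\<close> is bounded by an integral over a set that is the same for all
  \<open>h\<close> with \<open>\<parallel>R h\<parallel> \<le> \<rho>\<close>. Integrate over the translate by \<open>h\<close> of the symmetric set of mass at least \<open>1/2\<close>.
  The density changes by the factor \<open>exp (- (h \<bullet> x) - \<parallel>h\<parallel>\<^sup>2 / 2)\<close>; averaging over \<open>x\<close> and \<open>- x\<close> cancels the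
  linear exponent, and midpoint convexity returns \<open>F h\<close>. This plays the role of the variational
  formula for the relative entropy in PAC-Bayesian arguments.\<close>
lemma gauss_smoothing:
  fixes R :: "real^'d^'d" and F :: "real^'d \<Rightarrow> real"
  assumes R: "R \<noteq> 0" and [measurable]: "F \<in> borel_measurable borel"
    and conv: "\<And>x y. 2 * F x \<le> F (x + y) + F (x - y)"
    and h: "norm (R *v h) \<le> \<rho>"
  shows "ennreal (exp (F h - (norm h)\<^sup>2 / 2) / 2)
    \<le> (\<integral>\<^sup>+x. indicator {x. norm (R *v x) \<le> 2 * norm R + \<rho>} x * ennreal (exp (F x) * gauss_density x) \<partial>lborel)"
proof -
  let ?G = "{x. norm (R *v x) \<le> 2 * norm R}"
  let ?B = "{x. norm (R *v x) \<le> 2 * norm R + \<rho>}"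
  have [measurable]: "(\<lambda>x. R *v x) \<in> borel_measurable borel"
    by (intro borel_measurable_continuous_onI linear_continuous_on matrix_vector_mul_bounded_linear)
  define c where "c = exp (F h - (norm h)\<^sup>2 / 2)"
  have "ennreal (c / 2) = ennreal c * ennreal (1/2)"
    by (subst ennreal_mult'[symmetric]) (simp_all add: c_def)
  also have "\<dots> \<le> ennreal c * (\<integral>\<^sup>+x. indicator ?G x * ennreal (gauss_density x) \<partial>lborel)"
    by (intro mult_left_mono gauss_matrix_ball_mass R) simp
  also have "\<dots> = (\<integral>\<^sup>+x. ennreal c * (indicator ?G x * ennreal (gauss_density x)) \<partial>lborel)"
    by (simp add: nn_integral_cmult)
  also have "\<dots> \<le> (\<integral>\<^sup>+x. indicator ?G x * ennreal (exp (F (x + h)) * gauss_density (x + h)) \<partial>lborel)"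
  proof (rule nn_integral_symmetrize)
    fix x
    show "2 * (ennreal c * (indicator ?G x * ennreal (gauss_density x)))
      \<le> indicator ?G x * ennreal (exp (F (x + h)) * gauss_density (x + h))
        + indicator ?G (- x) * ennreal (exp (F (- x + h)) * gauss_density (- x + h))"
    proof (cases "x \<in> ?G")
      case True
      moreover have "R *v (- x) = - (R *v x)" using matrix_vector_mult_diff_distrib[of R 0 x] by simp
      ultimately have m: "- x \<in> ?G" by simp
      define a where "a = F (x + h) - h \<bullet> x"
      define b where "b = F (- x + h) + h \<bullet> x"
      have "2 * exp (F h) \<le> exp a + exp b"
      proof -
        have "2 * F h \<le> a + b" using conv[of h x] by (simp add: a_def b_def add.commute)
        \<comment> \<open>Midpoint convexity, followed by the inequality of arithmetic and geometric means.\<close>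
        hence "exp (F h) \<le> exp (a/2) * exp (b/2)" by (simp flip: exp_add)
        moreover have "2 * (exp (a/2) * exp (b/2)) \<le> (exp (a/2))\<^sup>2 + (exp (b/2))\<^sup>2"
          using sum_squares_bound[of "exp (a/2)" "exp (b/2)"] by (simp only: mult.assoc)
        moreover have "(exp (a/2))\<^sup>2 = exp a" "(exp (b/2))\<^sup>2 = exp b"
          by (simp_all add: power2_eq_square flip: exp_add)
        ultimately show ?thesis by linarith
      qed
      hence "2 * exp (F h) * (exp (- (norm h)\<^sup>2 / 2) * gauss_density x) \<le> (exp a + exp b) * (exp (- (norm h)\<^sup>2 / 2) * gauss_density x)"
        using gauss_density_pos[of x] by (intro mult_right_mono) auto
      also have "\<dots> = exp (F (x + h)) * gauss_density (x + h) + exp (F (- x + h)) * gauss_density (- x + h)"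
      proof -
        have "gauss_density (x + h) = gauss_density x * (exp (- (h \<bullet> x)) * exp (- (norm h)\<^sup>2 / 2))"
          using gauss_density_shift[of x h] by (simp flip: exp_add)
        moreover have "gauss_density (- x + h) = gauss_density x * (exp (h \<bullet> x) * exp (- (norm h)\<^sup>2 / 2))"
          using gauss_density_shift[of "- x" h] by (simp add: gauss_density_uminus flip: exp_add)
        moreover have "exp a = exp (F (x + h)) * exp (- (h \<bullet> x))" "exp b = exp (F (- x + h)) * exp (h \<bullet> x)"
          by (simp_all add: a_def b_def flip: exp_add)
        ultimately show ?thesis by (simp add: algebra_simps)
      qed
      also have "2 * exp (F h) * (exp (- (norm h)\<^sup>2 / 2) * gauss_density x) = 2 * (c * gauss_density x)"
      proof -
        have "c = exp (F h) * exp (- (norm h)\<^sup>2 / 2)" by (simp add: c_def flip: exp_add)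
        thus ?thesis by simp
      qed
      finally have "2 * (c * gauss_density x) \<le> exp (F (x + h)) * gauss_density (x + h) + exp (F (- x + h)) * gauss_density (- x + h)" .
      hence "ennreal (2 * (c * gauss_density x)) \<le> ennreal (exp (F (x + h)) * gauss_density (x + h) + exp (F (- x + h)) * gauss_density (- x + h))"
        by (rule ennreal_leI)
      thus ?thesis using True m gauss_density_pos[of x] gauss_density_pos[of "x + h"] gauss_density_pos[of "- x + h"]
        by (simp add: ennreal_mult c_def less_imp_le)
    qed simp
  qed measurable
  also have "\<dots> \<le> (\<integral>\<^sup>+x. indicator ?B (x + h) * ennreal (exp (F (x + h)) * gauss_density (x + h)) \<partial>lborel)"
  proof (intro nn_integral_mono mult_right_mono)
    fix x
    have "norm (R *v (x + h)) \<le> norm (R *v x) + norm (R *v h)"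
      unfolding matrix_vector_right_distrib by (rule norm_triangle_ineq)
    thus "indicator ?G x \<le> (indicator ?B (x + h) :: ennreal)"
      using h by (auto simp: indicator_def)
  qed simp
  also have "\<dots> = (\<integral>\<^sup>+x. indicator ?B x * ennreal (exp (F x) * gauss_density x) \<partial>lborel)"
    by (rule nn_integral_lborel_shift) measurable
  finally show ?thesis unfolding c_def .
qed

section \<open>Uniform tail bounds from pointwise exponential moments\<close>

text \<open>The random integral \<open>V\<close> dominates \<open>exp (F w h)\<close> for all admissible \<open>h\<close> at once, by
  \<open>gauss_smoothing\<close>. Its mean is at most \<open>exp b\<close> by Tonelli's theorem, so a single application of Markov's
  inequality covers all \<open>h\<close> without any union bound.\<close>
lemma (in prob_space) variational_tail_bound:
  fixes F :: "'a \<Rightarrow> real^'d \<Rightarrow> real" and R :: "real^'d^'d"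
  assumes R: "R \<noteq> 0" and F: "(\<lambda>(w, x). F w x) \<in> borel_measurable (M \<Otimes>\<^sub>M borel)"
    and conv: "\<And>w x y. 2 * F w x \<le> F w (x + y) + F w (x - y)"
    and mgf: "\<And>x. norm (R *v x) \<le> 2 * norm R + \<rho> \<Longrightarrow> (\<integral>\<^sup>+w. exp (F w x) \<partial>M) \<le> ennreal (exp b)"
    and \<delta>: "\<delta> > 0"
  shows "\<exists>E\<in>events. prob E \<ge> 1 - \<delta> \<and>
    (\<forall>w\<in>E. \<forall>h. norm (R *v h) \<le> \<rho> \<longrightarrow> F w h \<le> (norm h)\<^sup>2 / 2 + b + ln (2 / \<delta>))"
proof -
  let ?B = "{x. norm (R *v x) \<le> 2 * norm R + \<rho>}"
  have [measurable]: "(\<lambda>x. R *v x) \<in> borel_measurable borel"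
    by (intro borel_measurable_continuous_onI linear_continuous_on matrix_vector_mul_bounded_linear)
  have [measurable]: "(\<lambda>p. F (fst p) (snd p)) \<in> borel_measurable (M \<Otimes>\<^sub>M borel)"
    using F by (simp add: case_prod_unfold)
  define V where "V w = (\<integral>\<^sup>+x. indicator ?B x * ennreal (exp (F w x) * gauss_density x) \<partial>lborel)" for w
  have V_meas [measurable]: "V \<in> borel_measurable M"
    unfolding V_def by measurable
  interpret pair_sigma_finite M "lborel :: (real^'d) measure" ..
  have "(\<integral>\<^sup>+w. V w \<partial>M) = (\<integral>\<^sup>+x. (\<integral>\<^sup>+w. indicator ?B x * ennreal (exp (F w x) * gauss_density x) \<partial>M) \<partial>lborel)"
    unfolding V_def by (rule Fubini'[symmetric]) measurable
  also have "\<dots> \<le> (\<integral>\<^sup>+x. ennreal (exp b) * ennreal (gauss_density (x :: real^'d)) \<partial>lborel)"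
  proof (rule nn_integral_mono)
    fix x
    have [measurable]: "(\<lambda>w. F w x) \<in> borel_measurable M"
      using measurable_compose[OF measurable_Pair2'[of x borel M] F] by simp
    have "(\<integral>\<^sup>+w. indicator ?B x * ennreal (exp (F w x) * gauss_density x) \<partial>M)
      = (\<integral>\<^sup>+w. (indicator ?B x * ennreal (gauss_density x)) * ennreal (exp (F w x)) \<partial>M)"
      using gauss_density_pos[of x] by (intro nn_integral_cong) (simp add: ennreal_mult less_imp_le mult_ac)
    also have "\<dots> = (indicator ?B x * ennreal (gauss_density x)) * (\<integral>\<^sup>+w. ennreal (exp (F w x)) \<partial>M)"
      by (rule nn_integral_cmult) measurable
    also have "\<dots> \<le> ennreal (exp b) * ennreal (gauss_density x)"
      using mgf[of x] by (cases "x \<in> ?B") (auto simp: mult.commute intro: mult_left_mono)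
    finally show "(\<integral>\<^sup>+w. indicator ?B x * ennreal (exp (F w x) * gauss_density x) \<partial>M) \<le> \<dots>" .
  qed
  also have "\<dots> = ennreal (exp b)"
    by (simp add: nn_integral_cmult nn_integral_gauss_density)
  finally have EV: "(\<integral>\<^sup>+w. V w \<partial>M) \<le> ennreal (exp b)" .
  define c where "c = \<delta> * exp (- b)"
  have c: "c > 0" using \<delta> by (simp add: c_def)
  define A where "A = {w \<in> space M. 1 \<le> ennreal c * V w}"
  have A: "A \<in> events" unfolding A_def by measurable
  have "emeasure M A \<le> ennreal c * (\<integral>\<^sup>+w. V w * indicator (space M) w \<partial>M)"
    unfolding A_def by (rule nn_integral_Markov_inequality) auto
  also have "(\<integral>\<^sup>+w. V w * indicator (space M) w \<partial>M) = (\<integral>\<^sup>+w. V w \<partial>M)"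
    by (intro nn_integral_cong) auto
  also have "ennreal c * (\<integral>\<^sup>+w. V w \<partial>M) \<le> ennreal c * ennreal (exp b)" by (intro mult_left_mono EV) simp
  also have "\<dots> = ennreal \<delta>"
    using c by (simp add: ennreal_mult[symmetric] c_def mult.assoc flip: exp_add)
  finally have "prob A \<le> \<delta>" using \<delta> by (simp add: emeasure_eq_measure)
  hence "prob (space M - A) \<ge> 1 - \<delta>" using prob_compl[OF A] by simp
  moreover have "F w h \<le> (norm h)\<^sup>2 / 2 + b + ln (2 / \<delta>)"
    if w: "w \<in> space M - A" and h: "norm (R *v h) \<le> \<rho>" for w h
  proof -
    have [measurable]: "F w \<in> borel_measurable borel"
      using measurable_compose[OF measurable_Pair1'[of w M borel] F] w by simp
    have "ennreal c * ennreal (exp (F w h - (norm h)\<^sup>2 / 2) / 2) \<le> ennreal c * V w"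
      unfolding V_def by (intro mult_left_mono gauss_smoothing R conv h) simp_all
    also have "\<dots> < 1" using w by (simp add: A_def not_le)
    finally have "ennreal (c * (exp (F w h - (norm h)\<^sup>2 / 2) / 2)) < 1"
      using c by (subst ennreal_mult) simp_all
    hence lt: "c * (exp (F w h - (norm h)\<^sup>2 / 2) / 2) < 1"
      by (metis ennreal_1 ennreal_leI not_le)
    have "exp (F w h - (norm h)\<^sup>2 / 2 - b) < 2 / \<delta>"
    proof -
      have "exp (F w h - (norm h)\<^sup>2 / 2 - b) = exp (F w h - (norm h)\<^sup>2 / 2) * exp (- b)"
        by (simp flip: exp_add)
      thus ?thesis using lt \<delta> by (simp add: c_def pos_less_divide_eq mult_ac)
    qed
    hence "F w h - (norm h)\<^sup>2 / 2 - b < ln (2 / \<delta>)"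
      using \<delta> by (metis exp_gt_zero ln_exp ln_less_cancel_iff zero_less_divide_iff zero_less_numeral)
    thus ?thesis by simp
  qed
  ultimately show ?thesis using A by blast
qed

lemma (in prob_space) iid_exp_sum:
  fixes Y :: "'i \<Rightarrow> 'a \<Rightarrow> 'b::topological_space" and f :: "'b \<Rightarrow> real"
  assumes I: "finite I" and indep: "indep_vars (\<lambda>_. borel) Y I"
    and f: "f \<in> borel_measurable borel"
    and bound: "\<And>i. i \<in> I \<Longrightarrow> (\<integral>\<^sup>+w. exp (f (Y i w)) \<partial>M) \<le> ennreal (exp b)"
  shows "(\<integral>\<^sup>+w. exp (\<Sum>i\<in>I. f (Y i w)) \<partial>M) \<le> ennreal (exp (real (card I) * b))"
proof -
  have "indep_vars (\<lambda>_. borel) (\<lambda>i w. ennreal (exp (f (Y i w)))) I"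
    by (rule indep_vars_compose2[OF indep, where Y="\<lambda>_ y. ennreal (exp (f y))"]) (use f in measurable)
  from indep_vars_nn_integral[OF I this]
  have "(\<integral>\<^sup>+w. (\<Prod>i\<in>I. ennreal (exp (f (Y i w)))) \<partial>M) = (\<Prod>i\<in>I. \<integral>\<^sup>+w. ennreal (exp (f (Y i w))) \<partial>M)" by simp
  also have "\<dots> \<le> (\<Prod>i\<in>I. ennreal (exp b))" by (intro prod_mono_ennreal bound)
  also have "\<dots> = ennreal (exp (real (card I) * b))"
    by (simp add: ennreal_power exp_of_nat_mult)
  also have "(\<integral>\<^sup>+w. (\<Prod>i\<in>I. ennreal (exp (f (Y i w)))) \<partial>M) = (\<integral>\<^sup>+w. exp (\<Sum>i\<in>I. f (Y i w)) \<partial>M)"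
    using I by (simp add: prod_ennreal exp_sum)
  finally show ?thesis .
qed

lemma nn_integral_identically_distributed:
  assumes "distr M borel X = distr M borel Y"
    and [measurable]: "X \<in> borel_measurable M" "Y \<in> borel_measurable M" "f \<in> borel_measurable borel"
  shows "(\<integral>\<^sup>+w. f (X w) \<partial>M) = (\<integral>\<^sup>+w. f (Y w) \<partial>M)"
  using nn_integral_distr[of X M borel f] nn_integral_distr[of Y M borel f] assms by simp

lemma eff_rank_nonneg:
  fixes Sig :: "real^'d^'d"
  assumes "psd Sig"
  shows "0 \<le> eff_rank Sig"
proof -
  have "0 \<le> trace Sig" using norm_psd_sqrt[OF assms] by (metis zero_le_power2)
  moreover have "0 \<le> op_norm Sig" unfolding op_norm_def by (rule onorm_pos_le[OF matrix_vector_mul_bounded_linear])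
  ultimately show ?thesis by (simp add: eff_rank_def)
qed

lemma right_invertible_nonzero:
  assumes "A ** B = (mat 1 :: real^'d^'d)"
  shows "A \<noteq> 0"
proof
  assume "A = 0"
  have "x = A *v (B *v x)" for x :: "real^'d" using assms by (simp add: matrix_vector_mul_assoc)
  hence "x = 0" for x :: "real^'d" using \<open>A = 0\<close> by simp
  from this[of 1] show False by simp
qed

lemma op_norm_pos:
  assumes "invertible (Sig :: real^'d^'d)"
  shows "0 < op_norm Sig"
proof -
  have "Sig \<noteq> 0" using assms right_invertible_nonzero unfolding invertible_def by blast
  hence "\<exists>x. Sig *v x \<noteq> 0" by (metis matrix_eq matrix_vector_mult_0)
  thus ?thesis unfolding op_norm_def using onorm_pos_lt[OF matrix_vector_mul_bounded_linear] by blast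
qed

text \<open>In the tail bound, \<open>h = \<beta> u\<close> for a unit vector \<open>u\<close>. As soon as \<open>\<beta>\<^sup>2\<close> exceeds the effective rank, the
  contribution \<open>\<surd>(Tr \<Sigma>)\<close> of the Gaussian and the contribution \<open>\<beta> \<surd>\<parallel>\<Sigma>\<parallel>\<close> of the shift are of the same
  order, which is how the effective rank replaces the dimension.\<close>
lemma psd_sqrt_ball:
  fixes Sig :: "real^'d^'d"
  assumes psd: "psd Sig" and inv: "invertible Sig" and \<beta>: "eff_rank Sig \<le> \<beta>\<^sup>2" "0 \<le> \<beta>"
  shows "psd_sqrt Sig \<noteq> 0"
    and "norm (psd_sqrt Sig *v h) \<le> sqrt (op_norm Sig) * norm h"
    and "norm (psd_sqrt Sig *v x) \<le> 2 * norm (psd_sqrt Sig) + \<beta> * sqrt (op_norm Sig)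
      \<Longrightarrow> norm (psd_sqrt Sig *v x) \<le> 3 * \<beta> * sqrt (op_norm Sig)"
proof -
  note s0 = op_norm_pos[OF inv]
  show "psd_sqrt Sig \<noteq> 0"
    by (rule right_invertible_nonzero[OF psd_sqrt_inv_sqrt[OF psd inv]])
  have "(norm (psd_sqrt Sig *v h))\<^sup>2 \<le> norm h * norm (Sig *v h)"
    unfolding norm_psd_sqrt_mult[OF psd] by (rule norm_cauchy_schwarz)
  also have "\<dots> \<le> norm h * (op_norm Sig * norm h)" by (intro mult_left_mono op_norm_bound) simp
  also have "\<dots> = (sqrt (op_norm Sig) * norm h)\<^sup>2" using s0 by (simp add: power_mult_distrib power2_eq_square)
  finally show "norm (psd_sqrt Sig *v h) \<le> sqrt (op_norm Sig) * norm h"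
    by (rule power2_le_imp_le) (use s0 in simp)
  have "(norm (psd_sqrt Sig))\<^sup>2 = eff_rank Sig * op_norm Sig"
    using s0 by (simp add: norm_psd_sqrt[OF psd] eff_rank_def)
  also have "\<dots> \<le> (\<beta> * sqrt (op_norm Sig))\<^sup>2"
    using s0 \<beta> by (simp add: power_mult_distrib)
  finally have "norm (psd_sqrt Sig) \<le> \<beta> * sqrt (op_norm Sig)"
    by (rule power2_le_imp_le) (use s0 \<beta> in simp)
  thus "norm (psd_sqrt Sig *v x) \<le> 2 * norm (psd_sqrt Sig) + \<beta> * sqrt (op_norm Sig)
      \<Longrightarrow> norm (psd_sqrt Sig *v x) \<le> 3 * \<beta> * sqrt (op_norm Sig)" by linarith
qed

lemma inner_whiten:
  fixes Sig :: "real^'d^'d"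
  assumes "psd Sig" "invertible Sig"
  shows "x \<bullet> y = (psd_sqrt Sig *v x) \<bullet> (inv_sqrt Sig *v y)"
proof -
  have "transpose (psd_sqrt Sig) = psd_sqrt Sig" using psd_sqrt(1)[OF assms(1)] by (simp add: psd_def)
  from symmetric_inner[OF this, of x "inv_sqrt Sig *v y"] show ?thesis
    by (simp add: matrix_vector_mul_assoc psd_sqrt_inv_sqrt[OF assms])
qed

section \<open>The sample covariance matrix\<close>

text \<open>In terms of the whitened vector, \<open>(x \<bullet> X)\<^sup>2\<close> is the quadratic form of the rank-one matrix \<open>y y\<^sup>T\<close> with
  \<open>y = \<Sigma>\<^bsup>1/2\<^esup> x\<close>, whose trace and Frobenius norm are both \<open>\<parallel>y\<parallel>\<^sup>2\<close>.\<close>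
lemma (in prob_space) quadratic_mgf_bound_rank_one:
  fixes Sig :: "real^'d^'d"
  assumes psd: "psd Sig" "invertible Sig" and Q: "quadratic_mgf_bound M X Sig C"
    and q: "(norm (psd_sqrt Sig *v x))\<^sup>2 \<le> D" and D: "D > 0" and C: "C > 0" and s: "0 < s" "C * s * D \<le> 1" "C\<^sup>2 * s * D \<le> 1"
  shows "(\<integral>\<^sup>+w. exp (s * (x \<bullet> X w)\<^sup>2) \<partial>M) \<le> ennreal (exp (2 * s * D))"
proof -
  define y where "y = psd_sqrt Sig *v x"
  define B where "B = outer y y"
  have eq: "(inv_sqrt Sig *v X w) \<bullet> (B *v (inv_sqrt Sig *v X w)) = (x \<bullet> X w)\<^sup>2" for w
    unfolding B_def outer_mult_vec y_def
    by (simp add: inner_whiten[OF psd, of x] power2_eq_square inner_commute)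
  have yD: "(norm y)\<^sup>2 \<le> D" using q by (simp add: y_def)
  show ?thesis
  proof (cases "y = 0")
    case True
    hence "x \<bullet> X w = 0" for w using inner_whiten[OF psd, of x "X w"] by (simp add: y_def)
    moreover have "1 \<le> exp (2 * s * D)" using s D by simp
    ultimately show ?thesis using ennreal_leI[of 1 "exp (2 * s * D)"] by (simp add: emeasure_space_1)
  next
    case False
    hence B: "B \<noteq> 0" unfolding B_def using norm_outer[of y y] by auto
    have fB: "frob_norm B = (norm y)\<^sup>2"
      by (simp add: frob_norm_eq_norm B_def norm_outer power2_eq_square)
    have tB: "trace B = (norm y)\<^sup>2" by (simp add: B_def trace_outer power2_norm_eq_inner)
    have y0: "0 < (norm y)\<^sup>2" using False by simp
    have "C * s * (norm y)\<^sup>2 \<le> C * s * D" using yD C s by (intro mult_left_mono) auto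
    hence "C * \<bar>s\<bar> \<le> 1 / frob_norm B" unfolding fB using s y0 by (simp add: pos_le_divide_eq)
    with Q B have "integrable M (\<lambda>w. exp (s * ((inv_sqrt Sig *v X w) \<bullet> (B *v (inv_sqrt Sig *v X w)))))"
      and "ln (expectation (\<lambda>w. exp (s * ((inv_sqrt Sig *v X w) \<bullet> (B *v (inv_sqrt Sig *v X w))))))
        \<le> s * trace B + C\<^sup>2 * s\<^sup>2 * (frob_norm B)\<^sup>2"
      unfolding quadratic_mgf_bound_def by auto
    note int = this(1)[unfolded eq] and le = this(2)[unfolded eq tB fB]
    have "s * (norm y)\<^sup>2 + C\<^sup>2 * s\<^sup>2 * ((norm y)\<^sup>2)\<^sup>2 \<le> s * D + C\<^sup>2 * s\<^sup>2 * D\<^sup>2"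
      using yD s by (intro add_mono mult_left_mono power_mono) auto
    also have "C\<^sup>2 * s\<^sup>2 * D\<^sup>2 = (C\<^sup>2 * s * D) * (s * D)" by (simp add: power2_eq_square)
    also have "\<dots> \<le> 1 * (s * D)" using s D by (intro mult_right_mono) auto
    finally have le2: "ln (expectation (\<lambda>w. exp (s * (x \<bullet> X w)\<^sup>2))) \<le> 2 * s * D" using le by linarith
    have "expectation (\<lambda>w. exp (s * (x \<bullet> X w)\<^sup>2)) \<le> exp (2 * s * D)"
    proof (cases "expectation (\<lambda>w. exp (s * (x \<bullet> X w)\<^sup>2)) > 0")
      case True
      thus ?thesis using le2 by (metis exp_le_cancel_iff exp_ln)
    next
      case False
      thus ?thesis using exp_ge_zero[of "2 * s * D"] by linarith
    qed
    thus ?thesis by (subst nn_integral_eq_integral[OF int]) (auto intro: ennreal_leI)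
  qed
qed

text \<open>The function \<open>F\<close> is \<open>s\<close> times the sum of the \<open>(x \<bullet> X\<^sub>i)\<^sup>2\<close>. On the ball that matters the population value
  \<open>x \<bullet> \<Sigma> x\<close> is at most \<open>D = 9 \<beta>\<^sup>2 \<parallel>\<Sigma>\<parallel>\<close>, and the factor \<open>1 / (1 + C)\<^sup>2\<close> in \<open>s\<close> ensures both that (Q)
  applies and that its quadratic term is at most \<open>s D\<close>. The tail bound then yields \<open>2 D / \<beta>\<^sup>2 = 18 \<parallel>\<Sigma>\<parallel>\<close>
  plus a remainder that the lower bound on \<open>n\<close> makes smaller than \<open>\<parallel>\<Sigma>\<parallel>\<close>.\<close>
lemma (in prob_space) sample_covariance_bound:
  fixes X :: "nat \<Rightarrow> 'a \<Rightarrow> real^'d"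
  assumes indep: "indep_vars (\<lambda>_. borel) X {1..n}"
    and ident: "\<And>i. i \<in> {1..n} \<Longrightarrow> distr M borel (X i) = distr M borel (X 1)"
    and psd: "psd Sig" "invertible Sig"
    and C: "C > 0" and Q: "quadratic_mgf_bound M (X 1) Sig C"
    and \<delta>: "0 < \<delta>" "\<delta> < 1"
    and n: "2^11 * (1 + C)\<^sup>2 * (eff_rank Sig + ln (2 / \<delta>)) \<le> real n"
  shows "\<exists>E\<in>events. prob E \<ge> 1 - \<delta> \<and>
    (\<forall>w\<in>E. \<forall>v. (\<Sum>i=1..n. (v \<bullet> X i w)\<^sup>2) \<le> real n * (19 * op_norm Sig * (norm v)\<^sup>2))"
proof -
  define s0 where "s0 = op_norm Sig"
  define \<beta> where "\<beta> = sqrt (eff_rank Sig + ln (2 / \<delta>))"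
  define R where "R = psd_sqrt Sig"
  define D where "D = 9 * \<beta>\<^sup>2 * s0"
  define s where "s = 1 / ((1 + C)\<^sup>2 * D)"
  define F where "F w x = (\<Sum>i=1..n. s * (x \<bullet> X i w)\<^sup>2)" for w x
  have s0: "s0 > 0" using op_norm_pos[OF psd(2)] by (simp add: s0_def)
  have ln0: "0 < ln (2 / \<delta>)" using \<delta> by simp
  have \<beta>2: "\<beta>\<^sup>2 = eff_rank Sig + ln (2 / \<delta>)" using eff_rank_nonneg[OF psd(1)] ln0 by (simp add: \<beta>_def)
  have \<beta>: "\<beta> > 0" using eff_rank_nonneg[OF psd(1)] ln0 by (simp add: \<beta>_def)
  have D: "D > 0" using \<beta> s0 by (simp add: D_def)
  have s: "s > 0" using D C by (simp add: s_def)
  have n0: "n > 0"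
  proof -
    have "0 < 2^11 * (1 + C)\<^sup>2 * \<beta>\<^sup>2" using C \<beta> by simp
    thus ?thesis using n unfolding \<beta>2[symmetric] by linarith
  qed
  have rank: "eff_rank Sig \<le> \<beta>\<^sup>2" using \<beta>2 ln0 by simp
  note ball = psd_sqrt_ball[OF psd rank less_imp_le[OF \<beta>], folded R_def s0_def]
  have X [measurable]: "X i \<in> borel_measurable M" if "i \<in> {1..n}" for i
    using indep that by (simp add: indep_vars_def2)
  have X1: "X 1 \<in> borel_measurable M" using X[of 1] n0 by simp
  have F_meas: "(\<lambda>(w, x). F w x) \<in> borel_measurable (M \<Otimes>\<^sub>M borel)"
    unfolding F_def case_prod_unfold by measurable
  have conv: "2 * F w x \<le> F w (x + y) + F w (x - y)" for w x y
  proof -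
    have "F w (x + y) + F w (x - y) - 2 * F w x = (\<Sum>i=1..n. 2 * (s * (y \<bullet> X i w)\<^sup>2))"
      unfolding F_def sum.distrib[symmetric] sum_subtractf[symmetric] sum_distrib_left
      by (intro sum.cong) (auto simp: inner_simps power2_eq_square algebra_simps)
    also have "\<dots> \<ge> 0" using s by (intro sum_nonneg) auto
    finally show ?thesis by simp
  qed
  have mgf: "(\<integral>\<^sup>+w. exp (F w x) \<partial>M) \<le> ennreal (exp (real n * (2 * s * D)))"
    if "norm (R *v x) \<le> 2 * norm R + \<beta> * sqrt s0" for x
  proof -
    have "norm (R *v x) \<le> 3 * \<beta> * sqrt s0" by (rule ball(3)[OF that])
    hence "(norm (R *v x))\<^sup>2 \<le> (3 * \<beta> * sqrt s0)\<^sup>2" by (intro power_mono) auto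
    hence q: "(norm (psd_sqrt Sig *v x))\<^sup>2 \<le> D" using s0 by (simp add: D_def R_def power_mult_distrib)
    have c1: "C * s * D \<le> 1"
    proof -
      have "C * s * D = C / (1 + C)\<^sup>2" using D by (simp add: s_def)
      also have "\<dots> \<le> 1"
      proof (rule divide_le_eq_1_pos[THEN iffD2])
        show "0 < (1 + C)\<^sup>2" using C by simp
      qed (use C in \<open>simp add: power2_eq_square algebra_simps\<close>)
      finally show ?thesis .
    qed
    have c2: "C\<^sup>2 * s * D \<le> 1"
    proof -
      have "C\<^sup>2 * s * D = C\<^sup>2 / (1 + C)\<^sup>2" using D by (simp add: s_def)
      also have "\<dots> \<le> 1"
      proof (rule divide_le_eq_1_pos[THEN iffD2])
        show "0 < (1 + C)\<^sup>2" using C by simp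
      qed (use C in \<open>simp add: power2_eq_square algebra_simps\<close>)
      finally show ?thesis .
    qed
    have "(\<integral>\<^sup>+w. exp (s * (x \<bullet> X i w)\<^sup>2) \<partial>M) \<le> ennreal (exp (2 * s * D))" if "i \<in> {1..n}" for i
    proof -
      have "(\<integral>\<^sup>+w. ennreal (exp (s * (x \<bullet> X i w)\<^sup>2)) \<partial>M) = (\<integral>\<^sup>+w. ennreal (exp (s * (x \<bullet> X 1 w)\<^sup>2)) \<partial>M)"
        by (rule nn_integral_identically_distributed[OF ident[OF that] X[OF that] X1,
              where f="\<lambda>v. ennreal (exp (s * (x \<bullet> v)\<^sup>2))"]) measurable
      also have "\<dots> \<le> ennreal (exp (2 * s * D))"
        by (rule quadratic_mgf_bound_rank_one[OF psd Q q D C s c1 c2])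
      finally show ?thesis .
    qed
    from iid_exp_sum[where f="\<lambda>v. s * (x \<bullet> v)\<^sup>2", OF _ indep _ this]
    show ?thesis unfolding F_def by simp
  qed
  from variational_tail_bound[where F=F and \<rho>="\<beta> * sqrt s0" and b="real n * (2 * s * D)", OF ball(1) F_meas conv mgf \<delta>(1)]
  obtain E where E: "E \<in> events" "prob E \<ge> 1 - \<delta>"
    and bd: "\<And>w h. w \<in> E \<Longrightarrow> norm (R *v h) \<le> \<beta> * sqrt s0 \<Longrightarrow>
      F w h \<le> (norm h)\<^sup>2 / 2 + real n * (2 * s * D) + ln (2 / \<delta>)"
    by auto
  have "(\<Sum>i=1..n. (v \<bullet> X i w)\<^sup>2) \<le> real n * (19 * s0 * (norm v)\<^sup>2)" if w: "w \<in> E" for w v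
  proof (cases "v = 0")
    case False
    define u where "u = v /\<^sub>R norm v"
    have u: "norm u = 1" and v: "v = norm v *\<^sub>R u" using False by (auto simp: u_def)
    have "norm (R *v (\<beta> *\<^sub>R u)) \<le> \<beta> * sqrt s0" using ball(2)[of "\<beta> *\<^sub>R u"] u \<beta> by (simp add: mult.commute)
    from bd[OF w this] have "F w (\<beta> *\<^sub>R u) \<le> \<beta>\<^sup>2 / 2 + real n * (2 * s * D) + \<beta>\<^sup>2"
      using u \<beta> eff_rank_nonneg[OF psd(1)] by (simp add: \<beta>2)
    moreover have "F w (\<beta> *\<^sub>R u) = s * \<beta>\<^sup>2 * (\<Sum>i=1..n. (u \<bullet> X i w)\<^sup>2)"
      unfolding F_def sum_distrib_left by (simp add: power_mult_distrib mult.assoc)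
    ultimately have "s * \<beta>\<^sup>2 * (\<Sum>i=1..n. (u \<bullet> X i w)\<^sup>2) \<le> 3/2 * \<beta>\<^sup>2 + real n * (2 * s * D)" by linarith
    also have "\<dots> = s * \<beta>\<^sup>2 * (3/2 / s + 18 * real n * s0)"
      using s by (simp add: D_def field_simps)
    finally have "(\<Sum>i=1..n. (u \<bullet> X i w)\<^sup>2) \<le> 3/2 / s + 18 * real n * s0"
      by (rule mult_left_le_imp_le) (use s \<beta> in simp)
    also have "3/2 / s \<le> real n * s0"
    proof -
      have "3/2 / s = (27/2) * ((1 + C)\<^sup>2 * \<beta>\<^sup>2) * s0" by (simp add: s_def D_def)
      also have "\<dots> \<le> real n * s0"
      proof (rule mult_right_mono)
        have "27/2 * K \<le> real n" if "2048 * K \<le> real n" "0 \<le> K" for K using that by linarith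
        moreover have "2048 * ((1 + C)\<^sup>2 * \<beta>\<^sup>2) \<le> real n" using n unfolding \<beta>2 by (simp add: mult.assoc)
        ultimately show "(27/2) * ((1 + C)\<^sup>2 * \<beta>\<^sup>2) \<le> real n" by (simp only: mult_nonneg_nonneg zero_le_power2)
      qed (use s0 in simp)
      finally show ?thesis .
    qed
    finally have le: "(\<Sum>i=1..n. (u \<bullet> X i w)\<^sup>2) \<le> 19 * real n * s0" by linarith
    have "(\<Sum>i=1..n. (v \<bullet> X i w)\<^sup>2) = (norm v)\<^sup>2 * (\<Sum>i=1..n. (u \<bullet> X i w)\<^sup>2)"
      by (subst v) (simp add: power_mult_distrib sum_distrib_left)
    also have "\<dots> \<le> (norm v)\<^sup>2 * (19 * real n * s0)" by (intro mult_left_mono le) simp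
    finally show ?thesis by (simp add: mult_ac)
  qed simp
  thus ?thesis using E unfolding s0_def by blast
qed

section \<open>Averages of subexponential vectors\<close>

text \<open>Second-order Taylor expansion. With \<open>a = \<bar>\<xi>\<bar> / t\<close>, the remainder is at most \<open>(s t)\<^sup>2 / 2\<close> times
  \<open>a\<^sup>2 exp (a / 8)\<close>, and the square of \<open>a \<le> exp (7 a / 16)\<close> bounds \<open>a\<^sup>2\<close>.\<close>
lemma exp_le_exp_moment:
  fixes \<xi> s t :: real
  assumes t: "t > 0" and st: "\<bar>s\<bar> * t \<le> 1/8"
  shows "exp (s * \<xi>) \<le> 1 + s * \<xi> + (s * t)\<^sup>2 / 2 * exp (\<bar>\<xi>\<bar> / t)"
proof -
  define a where "a = \<bar>\<xi>\<bar> / t"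
  have a: "a \<ge> 0" using t by (simp add: a_def)
  have abs: "\<bar>s * \<xi>\<bar> = \<bar>s\<bar> * t * a" using t by (simp add: a_def abs_mult)
  obtain u where u: "\<bar>u\<bar> \<le> \<bar>s * \<xi>\<bar>" and eq: "exp (s * \<xi>) = (\<Sum>m<2. (s * \<xi>) ^ m / fact m) + exp u / fact 2 * (s * \<xi>) ^ 2"
    using Maclaurin_exp_le by blast
  have "exp (s * \<xi>) = 1 + s * \<xi> + exp u / 2 * (s * t)\<^sup>2 * a\<^sup>2"
  proof -
    have "(s * \<xi>)\<^sup>2 = (s * t)\<^sup>2 * a\<^sup>2"
      using t by (simp add: a_def power_mult_distrib power_divide)
    thus ?thesis unfolding eq by (simp add: numeral_2_eq_2)
  qed
  moreover have "exp u * a\<^sup>2 \<le> exp a"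
  proof -
    have "u \<le> a / 8" using u abs st mult_right_mono[OF st a] by linarith
    hence "exp u \<le> exp (a / 8)" by simp
    have "a \<le> 1 + 7/16 * a + (7/16 * a)\<^sup>2 / 2"
    proof -
      \<comment> \<open>Completing the square; the remaining constant is positive.\<close>
      have "1 + 7/16 * a + (7/16 * a)\<^sup>2 / 2 - a = 49/512 * (a - 144/49)\<^sup>2 + (1 - 49/512 * (144/49)\<^sup>2)"
        by (simp add: power2_eq_square field_simps)
      also have "\<dots> \<ge> 0" by (simp add: power2_eq_square)
      finally show ?thesis by simp
    qed
    also have "\<dots> \<le> exp (7/16 * a)" using exp_lower_Taylor_quadratic[of "7/16 * a"] a by simp
    finally have "a\<^sup>2 \<le> (exp (7/16 * a))\<^sup>2" using a by (intro power_mono)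
    also have "\<dots> = exp (7/8 * a)" by (simp add: power2_eq_square flip: exp_add)
    finally have "exp u * a\<^sup>2 \<le> exp (a / 8) * exp (7/8 * a)" using \<open>exp u \<le> exp (a / 8)\<close> by (intro mult_mono) auto
    also have "\<dots> = exp a" by (simp flip: exp_add)
    finally show ?thesis .
  qed
  hence "(s * t)\<^sup>2 / 2 * (exp u * a\<^sup>2) \<le> (s * t)\<^sup>2 / 2 * exp a" by (intro mult_left_mono) auto
  ultimately show ?thesis unfolding a_def[symmetric] by (simp add: mult_ac)
qed

lemma abs_le_scaled_exp:
  fixes x t :: real
  assumes "t > 0"
  shows "\<bar>x\<bar> \<le> t * exp (\<bar>x\<bar> / t)"
proof -
  have "\<bar>x\<bar> / t \<le> exp (\<bar>x\<bar> / t)" using exp_ge_add_one_self[of "\<bar>x\<bar> / t"] by linarith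
  thus ?thesis using assms by (simp add: pos_divide_le_eq mult.commute)
qed

lemma (in prob_space) integrable_exp_moment:
  assumes [measurable]: "\<xi> \<in> borel_measurable M" and t: "t > 0"
    and exp2: "(\<integral>\<^sup>+w. exp (\<bar>\<xi> w\<bar> / t) \<partial>M) \<le> 2"
  shows "integrable M (\<lambda>w. exp (\<bar>\<xi> w\<bar> / t))" "integrable M \<xi>" "expectation (\<lambda>w. exp (\<bar>\<xi> w\<bar> / t)) \<le> 2"
proof -
  show int: "integrable M (\<lambda>w. exp (\<bar>\<xi> w\<bar> / t))"
  proof (rule integrableI_bounded)
    show "(\<integral>\<^sup>+w. norm (exp (\<bar>\<xi> w\<bar> / t)) \<partial>M) < \<infinity>" using exp2 by (simp add: le_less_trans)
  qed measurable
  show "integrable M \<xi>"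
  proof (rule Bochner_Integration.integrable_bound)
    show "integrable M (\<lambda>w. t * exp (\<bar>\<xi> w\<bar> / t))" using int by simp
    have "\<bar>\<xi> w\<bar> \<le> t * exp (\<bar>\<xi> w\<bar> / t)" for w by (rule abs_le_scaled_exp[OF t])
    thus "AE w in M. norm (\<xi> w) \<le> norm (t * exp (\<bar>\<xi> w\<bar> / t))" using t by (auto simp: abs_mult)
  qed simp
  have "ennreal (expectation (\<lambda>w. exp (\<bar>\<xi> w\<bar> / t))) \<le> ennreal 2"
    using exp2 by (subst nn_integral_eq_integral[OF int, symmetric]) auto
  thus "expectation (\<lambda>w. exp (\<bar>\<xi> w\<bar> / t)) \<le> 2" by (subst (asm) ennreal_le_iff) auto
qed

lemma (in prob_space) subexponential_mgf:
  assumes [measurable]: "\<xi> \<in> borel_measurable M" and t: "t > 0"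
    and exp2: "(\<integral>\<^sup>+w. exp (\<bar>\<xi> w\<bar> / t) \<partial>M) \<le> 2"
    and mean: "expectation \<xi> = 0" and st: "\<bar>s\<bar> * t \<le> 1/8"
  shows "(\<integral>\<^sup>+w. exp (s * \<xi> w) \<partial>M) \<le> ennreal (exp ((s * t)\<^sup>2))"
proof -
  note int = integrable_exp_moment[OF assms(1) t exp2]
  let ?f = "\<lambda>w. 1 + s * \<xi> w + (s * t)\<^sup>2 / 2 * exp (\<bar>\<xi> w\<bar> / t)"
  have le: "exp (s * \<xi> w) \<le> ?f w" for w by (rule exp_le_exp_moment[OF t st])
  have "(\<integral>\<^sup>+w. exp (s * \<xi> w) \<partial>M) \<le> (\<integral>\<^sup>+w. ?f w \<partial>M)"
    by (intro nn_integral_mono ennreal_leI le)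
  also have "\<dots> = ennreal (expectation ?f)"
  proof (rule nn_integral_eq_integral)
    show "integrable M ?f" using int by simp
    show "AE w in M. 0 \<le> ?f w" using le exp_ge_zero order_trans by blast
  qed
  also have "expectation ?f = 1 + (s * t)\<^sup>2 / 2 * expectation (\<lambda>w. exp (\<bar>\<xi> w\<bar> / t))"
    using int mean by (simp add: prob_space)
  also have "\<dots> \<le> 1 + (s * t)\<^sup>2 / 2 * 2" by (intro add_left_mono mult_left_mono int) simp
  also have "\<dots> \<le> exp ((s * t)\<^sup>2)" using exp_ge_add_one_self[of "(s * t)\<^sup>2"] by simp
  finally show ?thesis by (simp add: ennreal_leI)
qed

lemma psi1_norm_less:
  assumes "psi1_norm M \<xi> < ennreal t"
  shows "(\<integral>\<^sup>+w. exp (\<bar>\<xi> w\<bar> / t) \<partial>M) \<le> 2"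
proof -
  obtain t' where t': "0 < t'" "(\<integral>\<^sup>+w. ennreal (exp (\<bar>\<xi> w\<bar> / t')) \<partial>M) \<le> 2" "ennreal t' < ennreal t"
    using assms unfolding psi1_norm_def INF_less_iff by auto
  have "t' < t" using t'(3) by (metis ennreal_leI not_le)
  hence "(\<integral>\<^sup>+w. ennreal (exp (\<bar>\<xi> w\<bar> / t)) \<partial>M) \<le> (\<integral>\<^sup>+w. ennreal (exp (\<bar>\<xi> w\<bar> / t')) \<partial>M)"
    using t'(1) by (intro nn_integral_mono ennreal_leI) (auto intro!: divide_left_mono)
  thus ?thesis using t'(2) by simp
qed

lemma psi1_norm_vec_less:
  assumes "psi1_norm_vec M \<nu> < ennreal t" "norm u = 1"
  shows "(\<integral>\<^sup>+w. exp (\<bar>u \<bullet> \<nu> w\<bar> / t) \<partial>M) \<le> 2"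
proof (rule psi1_norm_less)
  have "psi1_norm M (\<lambda>w. u \<bullet> \<nu> w) \<le> psi1_norm_vec M \<nu>"
    unfolding psi1_norm_vec_def by (rule SUP_upper) (use assms in simp)
  thus "psi1_norm M (\<lambda>w. u \<bullet> \<nu> w) < ennreal t" using assms(1) by simp
qed

text \<open>The exponential moment bounds the first absolute moment by \<open>2 t\<close>, for every \<open>t > 0\<close>.\<close>
lemma (in prob_space) psi1_norm_zero_imp:
  assumes "psi1_norm M \<xi> = 0" and [measurable]: "\<xi> \<in> borel_measurable M"
  shows "AE w in M. \<xi> w = 0"
proof -
  have "(\<integral>\<^sup>+w. ennreal \<bar>\<xi> w\<bar> \<partial>M) \<le> ennreal (2 * t)" if t: "t > 0" for t
  proof -
    have exp2: "(\<integral>\<^sup>+w. exp (\<bar>\<xi> w\<bar> / t) \<partial>M) \<le> 2"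
      by (rule psi1_norm_less) (use assms t in simp)
    have "\<bar>\<xi> w\<bar> \<le> t * exp (\<bar>\<xi> w\<bar> / t)" for w by (rule abs_le_scaled_exp[OF t])
    hence "(\<integral>\<^sup>+w. ennreal \<bar>\<xi> w\<bar> \<partial>M) \<le> (\<integral>\<^sup>+w. ennreal t * ennreal (exp (\<bar>\<xi> w\<bar> / t)) \<partial>M)"
      using t by (intro nn_integral_mono) (simp add: ennreal_mult'[symmetric] ennreal_leI)
    also have "\<dots> = ennreal t * (\<integral>\<^sup>+w. ennreal (exp (\<bar>\<xi> w\<bar> / t)) \<partial>M)"
      by (rule nn_integral_cmult) measurable
    also have "\<dots> \<le> ennreal t * ennreal 2" using exp2 by (intro mult_left_mono) auto
    also have "\<dots> = ennreal (2 * t)" using t by (subst ennreal_mult'[symmetric]) (auto simp: mult.commute)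
    finally show ?thesis .
  qed
  hence "(\<integral>\<^sup>+w. ennreal \<bar>\<xi> w\<bar> \<partial>M) \<le> ennreal e" if "e > 0" for e
    using that by (metis mult.commute nonzero_mult_div_cancel_right divide_pos_pos times_divide_eq_left zero_less_numeral zero_neq_numeral)
  hence "(\<integral>\<^sup>+w. ennreal \<bar>\<xi> w\<bar> \<partial>M) = 0"
    by (metis ennreal_le_epsilon add_0 le_zero_eq zero_le)
  thus ?thesis by (simp add: nn_integral_0_iff_AE)
qed

text \<open>Pull the factor that is measurable with respect to \<open>X\<close> out of the conditional expectation.\<close>
lemma (in prob_space) expectation_mult_cond_exp_zero:
  fixes X :: "'a \<Rightarrow> 'b::topological_space" and \<epsilon> :: "'a \<Rightarrow> real"
  assumes X: "X \<in> borel_measurable M" and [measurable]: "f \<in> borel_measurable borel"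
    and \<epsilon>: "\<epsilon> \<in> borel_measurable M"
    and ce: "AE w in M. real_cond_exp M (vimage_algebra (space M) X borel) \<epsilon> w = 0"
    and int: "integrable M (\<lambda>w. f (X w) * \<epsilon> w)"
  shows "expectation (\<lambda>w. f (X w) * \<epsilon> w) = 0"
proof -
  let ?G = "vimage_algebra (space M) X borel"
  have sub: "subalgebra M ?G"
    unfolding subalgebra_def using X by (auto simp: sets_vimage_algebra2 measurable_space intro: measurable_sets)
  interpret finite_measure_subalgebra M ?G by unfold_locales (rule sub)
  have "X \<in> measurable ?G borel"
    by (rule measurable_vimage_algebra1) auto
  hence f: "(\<lambda>w. f (X w)) \<in> borel_measurable ?G" by measurable
  have "expectation (\<lambda>w. f (X w) * \<epsilon> w) = expectation (\<lambda>w. f (X w) * real_cond_exp M ?G \<epsilon> w)"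
    using real_cond_exp_intg(2)[OF int f \<epsilon>] by simp
  also have "\<dots> = expectation (\<lambda>w. 0)"
    by (intro integral_cong_AE) (use ce X in \<open>auto intro!: borel_measurable_times\<close>)
  finally show ?thesis by simp
qed

text \<open>The same scheme with a linear function \<open>F\<close>. For a fixed \<open>x\<close>, the variable \<open>x \<bullet> V\<^sub>1\<close> is \<open>\<parallel>y\<parallel>\<close> times a
  unit projection of the whitened vector, with \<open>y = \<Sigma>\<^bsup>1/2\<^esup> x\<close> and \<open>\<parallel>y\<parallel> \<le> 3 \<beta> \<surd>\<parallel>\<Sigma>\<parallel>\<close>. The scale \<open>2 \<sigma>\<close> instead of \<open>\<sigma>\<close> is used
  in its exponential moment because the infimum defining the \<open>\<psi>\<^sub>1\<close> norm is then exceeded strictly, so that its attainment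
  is not an issue. The lower bound on \<open>n\<close> puts \<open>s\<close> into the range where the moment generating
  function is sub-Gaussian.\<close>
lemma (in prob_space) psi1_norm_vec_mean_bound:
  fixes V :: "nat \<Rightarrow> 'a \<Rightarrow> real^'d"
  assumes indep: "indep_vars (\<lambda>_. borel) V {1..n}"
    and ident: "\<And>i. i \<in> {1..n} \<Longrightarrow> distr M borel (V i) = distr M borel (V 1)"
    and mean: "\<And>x. integrable M (\<lambda>w. x \<bullet> V 1 w) \<Longrightarrow> expectation (\<lambda>w. x \<bullet> V 1 w) = 0"
    and psd: "psd Sig" "invertible Sig"
    and \<sigma>: "\<sigma> > 0" "psi1_norm_vec M (\<lambda>w. inv_sqrt Sig *v V 1 w) = ennreal \<sigma>"
    and \<delta>: "0 < \<delta>" "\<delta> < 1"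
    and n: "2^11 * (eff_rank Sig + ln (2 / \<delta>)) \<le> real n"
  shows "\<exists>E\<in>events. prob E \<ge> 1 - \<delta> \<and>
    (\<forall>w\<in>E. norm ((1 / real n) *\<^sub>R (\<Sum>i=1..n. V i w))
      \<le> 15 * \<sigma> * sqrt (op_norm Sig) * sqrt ((eff_rank Sig + ln (2 / \<delta>)) / real n))"
proof -
  define s0 where "s0 = op_norm Sig"
  define \<beta> where "\<beta> = sqrt (eff_rank Sig + ln (2 / \<delta>))"
  define R where "R = psd_sqrt Sig"
  define s where "s = 1 / (4 * \<sigma> * sqrt s0 * sqrt n)"
  define F where "F w x = (\<Sum>i=1..n. s * (x \<bullet> V i w))" for w x
  have s0: "s0 > 0" using op_norm_pos[OF psd(2)] by (simp add: s0_def)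
  have ln0: "0 < ln (2 / \<delta>)" using \<delta> by simp
  have \<beta>2: "\<beta>\<^sup>2 = eff_rank Sig + ln (2 / \<delta>)" using eff_rank_nonneg[OF psd(1)] ln0 by (simp add: \<beta>_def)
  have \<beta>: "\<beta> > 0" using eff_rank_nonneg[OF psd(1)] ln0 by (simp add: \<beta>_def)
  have n\<beta>: "2048 * \<beta>\<^sup>2 \<le> real n" using n unfolding \<beta>2 by simp
  have n0: "real n > 0" using n\<beta> \<beta> by (smt (verit) zero_less_power)
  have s: "s > 0" using n0 \<sigma> s0 by (simp add: s_def)
  have rank: "eff_rank Sig \<le> \<beta>\<^sup>2" using \<beta>2 ln0 by simp
  note ball = psd_sqrt_ball[OF psd rank less_imp_le[OF \<beta>], folded R_def s0_def]
  have V [measurable]: "V i \<in> borel_measurable M" if "i \<in> {1..n}" for i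
    using indep that by (simp add: indep_vars_def2)
  have V1 [measurable]: "V 1 \<in> borel_measurable M" using V[of 1] n0 by simp
  have F_meas: "(\<lambda>(w, x). F w x) \<in> borel_measurable (M \<Otimes>\<^sub>M borel)"
    unfolding F_def case_prod_unfold by measurable
  have conv: "2 * F w x \<le> F w (x + y) + F w (x - y)" for w x y
  proof -
    have "F w (x + y) + F w (x - y) = 2 * F w x"
      unfolding F_def sum.distrib[symmetric] sum_distrib_left
      by (intro sum.cong) (auto simp: inner_simps algebra_simps)
    thus ?thesis by simp
  qed
  have mgf: "(\<integral>\<^sup>+w. exp (F w x) \<partial>M) \<le> ennreal (exp (real n * (9/4 * \<beta>\<^sup>2 / real n)))"
    if "norm (R *v x) \<le> 2 * norm R + \<beta> * sqrt s0" for x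
  proof -
    have q: "norm (R *v x) \<le> 3 * \<beta> * sqrt s0" by (rule ball(3)[OF that])
    define y where "y = R *v x"
    define u where "u = (if y = 0 then axis undefined 1 else y /\<^sub>R norm y)"
    have u: "norm u = 1" and y: "y = norm y *\<^sub>R u" by (auto simp: u_def)
    define \<xi> where "\<xi> w = u \<bullet> (inv_sqrt Sig *v V 1 w)" for w
    have x\<xi>: "x \<bullet> V 1 w = norm y * \<xi> w" for w
      using inner_whiten[OF psd, of x "V 1 w"] y by (metis R_def \<xi>_def inner_scaleR_left y_def)
    have \<xi> [measurable]: "\<xi> \<in> borel_measurable M"
    proof -
      have "(\<lambda>v. u \<bullet> (inv_sqrt Sig *v v)) \<in> borel_measurable borel"
        by (intro borel_measurable_continuous_onI continuous_intros linear_continuous_on matrix_vector_mul_bounded_linear)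
      thus ?thesis unfolding \<xi>_def using V1 by (rule measurable_compose[rotated])
    qed
    have exp2: "(\<integral>\<^sup>+w. exp (\<bar>\<xi> w\<bar> / (2 * \<sigma>)) \<partial>M) \<le> 2"
      unfolding \<xi>_def by (rule psi1_norm_vec_less) (use \<sigma> u in \<open>auto simp: ennreal_less_iff\<close>)
    have mean\<xi>: "expectation \<xi> = 0"
    proof -
      have *: "\<xi> w = (transpose (inv_sqrt Sig) *v u) \<bullet> V 1 w" for w
        unfolding \<xi>_def using inner_mat_transpose[of "V 1 w" "inv_sqrt Sig" u] by (simp only: inner_commute)
      have "integrable M \<xi>" using integrable_exp_moment(2)[OF \<xi> _ exp2] \<sigma> by simp
      thus ?thesis using mean[of "transpose (inv_sqrt Sig) *v u"] unfolding *[abs_def] by simp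
    qed
    have st: "s * norm y * (2 * \<sigma>) \<le> 3/2 * (\<beta> / sqrt n)"
    proof -
      have "s * norm y * (2 * \<sigma>) \<le> s * (3 * \<beta> * sqrt s0) * (2 * \<sigma>)"
        using q s \<sigma> unfolding y_def by (intro mult_right_mono mult_left_mono) auto
      also have "\<dots> = 3/2 * (\<beta> / sqrt n)" using \<sigma> s0 n0 by (simp add: s_def)
      finally show ?thesis .
    qed
    have small: "\<beta> / sqrt n \<le> 1/12"
    proof (rule power2_le_imp_le)
      have "\<beta>\<^sup>2 / real n \<le> 1/144" using n\<beta> n0 by (simp add: pos_divide_le_eq)
      thus "(\<beta> / sqrt n)\<^sup>2 \<le> (1/12)\<^sup>2" using n0 by (simp add: power_divide)
    qed simp
    have "(\<integral>\<^sup>+w. exp ((s * norm y) * \<xi> w) \<partial>M) \<le> ennreal (exp ((s * norm y * (2 * \<sigma>))\<^sup>2))"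
    proof (rule subexponential_mgf[OF \<xi> _ exp2 mean\<xi>])
      have "\<bar>s * norm y\<bar> * (2 * \<sigma>) = s * norm y * (2 * \<sigma>)" using s by simp
      also have "\<dots> \<le> 1/8" using st small by linarith
      finally show "\<bar>s * norm y\<bar> * (2 * \<sigma>) \<le> 1/8" .
    qed (use \<sigma> in simp)
    also have "\<dots> \<le> ennreal (exp (9/4 * \<beta>\<^sup>2 / real n))"
    proof (intro ennreal_leI, unfold exp_le_cancel_iff)
      have "(s * norm y * (2 * \<sigma>))\<^sup>2 \<le> (3/2 * (\<beta> / sqrt n))\<^sup>2" using s \<sigma> st by (intro power_mono) auto
      thus "(s * norm y * (2 * \<sigma>))\<^sup>2 \<le> 9/4 * \<beta>\<^sup>2 / real n" using n0 by (simp add: power_mult_distrib power_divide)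
    qed
    finally have one: "(\<integral>\<^sup>+w. exp (s * (x \<bullet> V 1 w)) \<partial>M) \<le> ennreal (exp (9/4 * \<beta>\<^sup>2 / real n))"
      unfolding x\<xi> by (simp only: mult.assoc)
    have "(\<integral>\<^sup>+w. exp (s * (x \<bullet> V i w)) \<partial>M) \<le> ennreal (exp (9/4 * \<beta>\<^sup>2 / real n))" if "i \<in> {1..n}" for i
    proof -
      have "(\<integral>\<^sup>+w. ennreal (exp (s * (x \<bullet> V i w))) \<partial>M) = (\<integral>\<^sup>+w. ennreal (exp (s * (x \<bullet> V 1 w))) \<partial>M)"
        by (rule nn_integral_identically_distributed[OF ident[OF that] V[OF that] V1,
              where f="\<lambda>v. ennreal (exp (s * (x \<bullet> v)))"]) measurable
      thus ?thesis using one by simp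
    qed
    from iid_exp_sum[where f="\<lambda>v. s * (x \<bullet> v)", OF _ indep _ this]
    show ?thesis unfolding F_def by simp
  qed
  from variational_tail_bound[where F=F and \<rho>="\<beta> * sqrt s0" and b="real n * (9/4 * \<beta>\<^sup>2 / real n)", OF ball(1) F_meas conv mgf \<delta>(1)]
  obtain E where E: "E \<in> events" "prob E \<ge> 1 - \<delta>"
    and bd: "\<And>w h. w \<in> E \<Longrightarrow> norm (R *v h) \<le> \<beta> * sqrt s0 \<Longrightarrow>
      F w h \<le> (norm h)\<^sup>2 / 2 + real n * (9/4 * \<beta>\<^sup>2 / real n) + ln (2 / \<delta>)"
    by auto
  have "norm ((1 / real n) *\<^sub>R (\<Sum>i=1..n. V i w)) \<le> 15 * \<sigma> * sqrt s0 * sqrt ((eff_rank Sig + ln (2 / \<delta>)) / real n)"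
    if w: "w \<in> E" for w
  proof -
    define v where "v = (\<Sum>i=1..n. V i w)"
    define u where "u = (if v = 0 then axis undefined 1 else v /\<^sub>R norm v)"
    have u: "norm u = 1" by (auto simp: u_def)
    have uv: "u \<bullet> v = norm v" by (auto simp: u_def power2_norm_eq_inner[symmetric] power2_eq_square)
    have "norm (R *v (\<beta> *\<^sub>R u)) \<le> \<beta> * sqrt s0" using ball(2)[of "\<beta> *\<^sub>R u"] u \<beta> by (simp add: mult.commute)
    from bd[OF w this] have "F w (\<beta> *\<^sub>R u) \<le> \<beta>\<^sup>2 / 2 + 9/4 * \<beta>\<^sup>2 + \<beta>\<^sup>2"
      using u \<beta> n0 eff_rank_nonneg[OF psd(1)] by (simp add: \<beta>2)
    moreover have "F w (\<beta> *\<^sub>R u) = s * \<beta> * norm v"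
    proof -
      have "F w (\<beta> *\<^sub>R u) = s * \<beta> * (u \<bullet> v)"
        unfolding F_def v_def by (simp add: inner_sum_right sum_distrib_left mult.assoc)
      thus ?thesis by (simp only: uv)
    qed
    ultimately have "s * \<beta> * norm v \<le> s * \<beta> * (15/4 * \<beta> / s)" using s by (simp add: power2_eq_square)
    hence "norm v \<le> 15/4 * \<beta> / s" by (rule mult_left_le_imp_le) (use s \<beta> in simp)
    hence "norm v / real n \<le> (15/4 * \<beta> / s) / real n" using n0 by (intro divide_right_mono) auto
    also have "\<dots> = 15 * \<sigma> * sqrt s0 * (\<beta> * (sqrt n / real n))" by (simp add: s_def)
    also have "sqrt n / real n = 1 / sqrt n" using n0 by (simp add: real_div_sqrt field_simps)
    finally show ?thesis unfolding v_def[symmetric] using n0 by (simp add: \<beta>_def real_sqrt_divide)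
  qed
  thus ?thesis using E unfolding s0_def by blast
qed

text \<open>The degenerate noise level \<open>\<sigma> = 0\<close>, for which the parameter \<open>s\<close>, proportional to \<open>1 / \<sigma>\<close>, is not
  available.\<close>
lemma (in prob_space) psi1_norm_vec_zero_imp:
  fixes V :: "nat \<Rightarrow> 'a \<Rightarrow> real^'d"
  assumes V: "\<And>i. i \<in> {1..n} \<Longrightarrow> V i \<in> borel_measurable M"
    and ident: "\<And>i. i \<in> {1..n} \<Longrightarrow> distr M borel (V i) = distr M borel (V 1)"
    and psd: "psd Sig" "invertible Sig"
    and zero: "psi1_norm_vec M (\<lambda>w. inv_sqrt Sig *v V 1 w) = 0"
  shows "\<exists>E\<in>events. prob E = 1 \<and> (\<forall>w\<in>E. \<forall>i\<in>{1..n}. V i w = 0)"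
proof -
  have "AE w in M. V i w = 0" if i: "i \<in> {1..n}" for i
  proof -
    have V1 [measurable]: "V 1 \<in> borel_measurable M" using V[of 1] i by simp
    have "AE w in M. (inv_sqrt Sig *v V 1 w) $ j = 0" for j
    proof -
      have "psi1_norm M (\<lambda>w. axis j 1 \<bullet> (inv_sqrt Sig *v V 1 w)) \<le> psi1_norm_vec M (\<lambda>w. inv_sqrt Sig *v V 1 w)"
        unfolding psi1_norm_vec_def by (rule SUP_upper) simp
      hence "psi1_norm M (\<lambda>w. axis j 1 \<bullet> (inv_sqrt Sig *v V 1 w)) = 0" using zero by simp
      moreover have "(\<lambda>w. axis j 1 \<bullet> (inv_sqrt Sig *v V 1 w)) \<in> borel_measurable M"
      proof -
        have "(\<lambda>v. axis j 1 \<bullet> (inv_sqrt Sig *v v)) \<in> borel_measurable borel"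
          by (intro borel_measurable_continuous_onI continuous_intros linear_continuous_on matrix_vector_mul_bounded_linear)
        thus ?thesis using V1 by (rule measurable_compose[rotated])
      qed
      ultimately have "AE w in M. axis j 1 \<bullet> (inv_sqrt Sig *v V 1 w) = 0" by (rule psi1_norm_zero_imp)
      thus ?thesis by (simp add: inner_axis')
    qed
    hence "AE w in M. \<forall>j. (inv_sqrt Sig *v V 1 w) $ j = 0" by (simp add: AE_all_countable)
    hence "AE w in M. V 1 w = 0"
    proof eventually_elim
      case (elim w)
      hence "inv_sqrt Sig *v V 1 w = 0" by (simp add: vec_eq_iff)
      hence "V 1 w \<bullet> V 1 w = 0" using inner_whiten[OF psd, of "V 1 w" "V 1 w"] by simp
      thus ?case by simp
    qed
    hence "AE v in distr M borel (V 1). v = 0" by (subst AE_distr_iff[OF V1]) (auto simp del: One_nat_def)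
    hence "AE v in distr M borel (V i). v = 0" by (simp only: ident[OF i])
    thus ?thesis by (subst (asm) AE_distr_iff[OF V[OF i]]) auto
  qed
  hence ae: "AE w in M. \<forall>i\<in>{1..n}. V i w = 0" by (intro AE_finite_allI) auto
  define E where "E = {w \<in> space M. \<forall>i\<in>{1..n}. V i w = 0}"
  have E: "E \<in> events"
  proof -
    have "{w \<in> space M. V i w = 0} \<in> events" if "i \<in> {1..n}" for i
      using measurable_sets[OF V[OF that], of "{0}"] by (simp add: vimage_def Int_def conj_commute)
    thus ?thesis unfolding E_def by (intro sets.sets_Collect_finite_All) auto
  qed
  have "prob E = 1" using ae E by (subst prob_eq_1) (auto simp: E_def)
  thus ?thesis using E by (auto simp: E_def)
qed

section \<open>Convergence of the alternating minimization\<close>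

lemma sum_outer_mult_vec:
  fixes x y :: "'i \<Rightarrow> real^'d"
  assumes "finite I"
  shows "(\<Sum>i\<in>I. outer (x i) (y i)) *v v = (\<Sum>i\<in>I. (y i \<bullet> v) *\<^sub>R x i)"
  using assms by (induction I rule: finite_induct) (auto simp: matrix_vector_mult_add_rdistrib outer_mult_vec)

text \<open>For a Gram matrix, a bound on the quadratic form is a bound on the operator norm, by the
  Cauchy--Schwarz inequality for sums.\<close>
lemma norm_gram_mult_le:
  fixes x :: "'i \<Rightarrow> real^'d"
  assumes I: "finite I" and c: "c \<ge> 0" and K: "K \<ge> 0"
    and bound: "\<And>v. c * (\<Sum>i\<in>I. (v \<bullet> x i)\<^sup>2) \<le> K * (norm v)\<^sup>2"
  shows "norm ((c *\<^sub>R (\<Sum>i\<in>I. outer (x i) (x i))) *v v) \<le> K * norm v"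
proof -
  define S where "S = c *\<^sub>R (\<Sum>i\<in>I. outer (x i) (x i))"
  define y where "y = S *v v"
  have Sv: "y = c *\<^sub>R (\<Sum>i\<in>I. (x i \<bullet> v) *\<^sub>R x i)"
    unfolding y_def S_def by (simp add: sum_outer_mult_vec[OF I] flip: scaleR_matrix_vector_assoc)
  have "(norm y)\<^sup>2 = c * (\<Sum>i\<in>I. (v \<bullet> x i) * (y \<bullet> x i))"
    unfolding power2_norm_eq_inner by (subst (2) Sv) (simp add: inner_sum_right inner_commute)
  hence "((norm y)\<^sup>2)\<^sup>2 = c\<^sup>2 * (\<Sum>i\<in>I. (v \<bullet> x i) * (y \<bullet> x i))\<^sup>2"
    by (simp only: power_mult_distrib)
  also have "\<dots> \<le> c\<^sup>2 * ((\<Sum>i\<in>I. (v \<bullet> x i)\<^sup>2) * (\<Sum>i\<in>I. (y \<bullet> x i)\<^sup>2))"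
    by (intro mult_left_mono Cauchy_Schwarz_ineq_sum) simp
  also have "\<dots> = (c * (\<Sum>i\<in>I. (v \<bullet> x i)\<^sup>2)) * (c * (\<Sum>i\<in>I. (y \<bullet> x i)\<^sup>2))"
    by (simp add: power2_eq_square mult_ac)
  also have "\<dots> \<le> (K * (norm v)\<^sup>2) * (K * (norm y)\<^sup>2)"
    using c K by (intro mult_mono bound) (auto intro!: mult_nonneg_nonneg sum_nonneg)
  also have "\<dots> = (K * norm v * norm y)\<^sup>2" by (simp add: power_mult_distrib power2_eq_square)
  finally have "(norm y)\<^sup>2 \<le> K * norm v * norm y" by (rule power2_le_imp_le) (use K in simp)
  hence "norm y \<le> K * norm v" using K by (cases "y = 0") (auto simp: power2_eq_square)
  thus ?thesis unfolding y_def S_def .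
qed

lemma psd_second_moment:
  fixes X :: "'w \<Rightarrow> real^'d"
  assumes iO: "integrable M (\<lambda>w. outer (X w) (X w))"
  shows "psd (integral\<^sup>L M (\<lambda>w. outer (X w) (X w)))"
proof -
  define S where "S = integral\<^sup>L M (\<lambda>w. outer (X w) (X w))"
  have S: "x \<bullet> (S *v y) = (\<integral>w. (x \<bullet> X w) * (y \<bullet> X w) \<partial>M)" for x y
  proof -
    have "x \<bullet> (S *v y) = outer x y \<bullet> S" by (simp add: inner_outer)
    also have "\<dots> = (\<integral>w. outer x y \<bullet> outer (X w) (X w) \<partial>M)"
      unfolding S_def by (rule integral_inner_right[symmetric]) (rule iO)
    also have "\<dots> = (\<integral>w. (x \<bullet> X w) * (y \<bullet> X w) \<partial>M)"
      by (simp add: inner_outer outer_mult_vec inner_commute mult.commute)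
    finally show ?thesis .
  qed
  have "S $ i $ j = S $ j $ i" for i j
  proof -
    have comp: "S $ i $ j = axis i 1 \<bullet> (S *v axis j 1)" for i j
      by (simp add: matrix_vector_mult_basis column_def inner_axis')
    show ?thesis unfolding comp S by (simp add: mult.commute)
  qed
  moreover have "0 \<le> x \<bullet> (S *v x)" for x unfolding S by (simp flip: power2_eq_square)
  ultimately show ?thesis unfolding psd_def S_def[symmetric] by (simp add: transpose_def vec_eq_iff)
qed

theorem theorem3p3:
  fixes M :: "'w measure"
    and X :: "nat \<Rightarrow> 'w \<Rightarrow> real^'d"
    and \<epsilon> Y :: "nat \<Rightarrow> 'w \<Rightarrow> real"
    and \<theta>0 :: "real^'d"
    and Sig :: "real^'d^'d"
    and C\<^sub>X \<sigma> \<delta> \<rho>\<^sub>0 \<mu> lam :: real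
    and n T :: nat
    and Sighat :: "'w \<Rightarrow> real^'d^'d"
    and Z :: "'w \<Rightarrow> real^'d"
    and \<theta>hat :: "'w \<Rightarrow> real^'d"
    and \<theta> :: "nat \<Rightarrow> 'w \<Rightarrow> real^'d"
    and A :: "nat \<Rightarrow> 'w \<Rightarrow> real^'d^'d"
  assumes "prob_space M"
    and indep: "prob_space.indep_vars M (\<lambda>_. borel) (\<lambda>i w. (X i w, \<epsilon> i w)) {1..n}"
    and ident: "\<And>i. i \<in> {1..n} \<Longrightarrow>
      distr M borel (\<lambda>w. (X i w, \<epsilon> i w)) = distr M borel (\<lambda>w. (X 1 w, \<epsilon> 1 w))"
    and sq_integrable: "integrable M (\<lambda>w. (norm (X 1 w))\<^sup>2)"
    and Sig: "Sig = integral\<^sup>L M (\<lambda>w. outer (X 1 w) (X 1 w))"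
    and inv: "invertible Sig"
    and Q: "C\<^sub>X > 0" "quadratic_mgf_bound M (X 1) Sig C\<^sub>X"
    and N_cond: "integrable M (\<epsilon> 1)"
      "AE w in M. real_cond_exp M (vimage_algebra (space M) (X 1) borel) (\<epsilon> 1) w = 0"
    and N_psi1: "\<sigma> \<ge> 0"
      "psi1_norm_vec M (\<lambda>w. inv_sqrt Sig *v (\<epsilon> 1 w *\<^sub>R X 1 w)) = ennreal \<sigma>"
    and Y: "\<And>i w. Y i w = X i w \<bullet> \<theta>0 + \<epsilon> i w"
    and Sighat: "\<And>w. Sighat w = (1 / real n) *\<^sub>R (\<Sum>i=1..n. outer (X i w) (X i w))"
    and Z: "\<And>w. Z w = (1 / real n) *\<^sub>R (\<Sum>i=1..n. Y i w *\<^sub>R X i w)"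
    and \<delta>: "0 < \<delta>" "\<delta> < 1"
    and \<rho>0: "0 < \<rho>\<^sub>0" "\<rho>\<^sub>0 \<le> 1/8"
    and n: "real n \<ge> 2^12 * (1 + C\<^sub>X)\<^sup>2 * (eff_rank Sig + ln (2 / \<delta>))"
    and pos: "\<mu> > 0" "lam > 0"
    and cond1: "norm \<theta>0 \<le> \<rho>\<^sub>0 * \<mu> / 7"
    and cond2: "op_norm Sig * norm \<theta>0 \<le> \<rho>\<^sub>0 * \<mu> * sqrt lam / (56 * 18)"
    and cond3: "lam \<ge> 2^13 * (1 + C\<^sub>X) * (op_norm Sig)\<^sup>2 * norm \<theta>0 / (\<rho>\<^sub>0 * \<mu>)
      * sqrt ((4 * eff_rank Sig + ln (2 / \<delta>)) / real n)"
    and cond4: "min (lam / op_norm Sig) (sqrt lam) \<ge>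
      2^11 * \<sigma> * sqrt (op_norm Sig) / (\<rho>\<^sub>0 * \<mu>)
      * sqrt ((eff_rank Sig + ln (4 / \<delta>)) / real n)"
    and \<theta>hat: "\<And>w. w \<in> space M \<Longrightarrow>
      \<exists>\<eta>' A'. is_arg_min (objective (Z w) (Sighat w) \<mu> lam) (\<lambda>_. True) (\<theta>hat w, \<eta>', A')"
    and T: "T \<ge> 1"
    and A_0: "\<And>w. A 0 w = Sighat w"
    and \<theta>_t: "\<And>t w. t \<in> {1..T} \<Longrightarrow>
      \<theta> t w = matrix_inv (transpose (A (t - 1) w) ** A (t - 1) w + mat (2 * lam))
        *v (transpose (A (t - 1) w) *v Z w)"
    and A_t: "\<And>t w. t \<in> {1..T} \<Longrightarrow>
      A t w = outer (Z w) (\<theta> t w) ** matrix_inv (mat (2 * \<mu>\<^sup>2) + outer (\<theta> t w) (\<theta> t w))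
        + Sighat w ** matrix_inv (mat 1 + (1 / (2 * \<mu>\<^sup>2)) *\<^sub>R outer (\<theta> t w) (\<theta> t w))"
  shows "\<exists>E \<in> sets M. measure M E \<ge> 1 - \<delta> \<and>
    (\<forall>w\<in>E. norm (\<theta> T w - \<theta>hat w) \<le>
       \<rho>\<^sub>0 ^ (2 * (T - 1)) *
       (norm \<theta>0 + 8 * \<sigma> * sqrt (op_norm Sig)
          * sqrt ((eff_rank Sig + ln (4 / \<delta>)) / (lam * real n))))"
proof -
  interpret prob_space M by fact
  define s0 where "s0 = op_norm Sig"
  define L where "L = sqrt lam"
  define a where "a = norm \<theta>0"
  define b where "b = sqrt ((eff_rank Sig + ln (4 / \<delta>)) / real n)"
  define c where "c = \<sigma> * sqrt s0 * b"
  define V where "V i w = \<epsilon> i w *\<^sub>R X i w" for i w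
  have L: "L > 0" "lam = L\<^sup>2" using pos by (auto simp: L_def)
  have s0: "s0 > 0" using op_norm_pos[OF inv] by (simp add: s0_def)
  have "Sig \<noteq> 0" using inv right_invertible_nonzero unfolding invertible_def by blast
  \<comment> \<open>The integral of a function that is not integrable is \<open>0\<close>, which is not invertible.\<close>
  hence "integrable M (\<lambda>w. outer (X 1 w) (X 1 w))"
    using not_integrable_integral_eq unfolding Sig by blast
  hence psd: "psd Sig" unfolding Sig by (rule psd_second_moment)
  note r0 = eff_rank_nonneg[OF psd]
  have ln2: "ln (2::real) \<le> ln (2 / \<delta>)" and ln0: "0 < ln (2 / \<delta>)" using \<delta> by (simp_all add: field_simps)
  have ln4: "ln (4 / \<delta>) \<le> 2 * ln (2 / \<delta>)" "0 < ln (4 / \<delta>)"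
  proof -
    have "ln (2 * (2 / \<delta>)) = ln 2 + ln (2 / \<delta>)" using \<delta> by (intro ln_mult_pos) auto
    thus "ln (4 / \<delta>) \<le> 2 * ln (2 / \<delta>)" using ln2 by simp
    show "0 < ln (4 / \<delta>)" using \<delta> by simp
  qed
  \<comment> \<open>Each of the two concentration bounds is used at confidence level \<open>1 - \<delta> / 2\<close>.\<close>
  have half: "2 / (\<delta> / 2) = 4 / \<delta>" by simp
  have sample: "2^11 * (1 + C\<^sub>X)\<^sup>2 * (eff_rank Sig + ln (2 / (\<delta> / 2))) \<le> real n"
  proof -
    have "2^11 * (1 + C\<^sub>X)\<^sup>2 * (eff_rank Sig + ln (4 / \<delta>)) \<le> 2^11 * (1 + C\<^sub>X)\<^sup>2 * (2 * (eff_rank Sig + ln (2 / \<delta>)))"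
      using ln4 r0 by (intro mult_left_mono) auto
    also have "\<dots> = 2^12 * (1 + C\<^sub>X)\<^sup>2 * (eff_rank Sig + ln (2 / \<delta>))" by simp
    finally show ?thesis using n unfolding half by linarith
  qed
  have sample': "2^11 * (eff_rank Sig + ln (2 / (\<delta> / 2))) \<le> real n"
  proof -
    have "2^11 * 1 * (eff_rank Sig + ln (4 / \<delta>)) \<le> 2^11 * (1 + C\<^sub>X)\<^sup>2 * (eff_rank Sig + ln (4 / \<delta>))"
      using Q(1) ln4 r0 by (intro mult_right_mono mult_left_mono) auto
    thus ?thesis using sample unfolding half by linarith
  qed
  have n0: "n > 0"
  proof -
    have "0 < 2^11 * (eff_rank Sig + ln (4 / \<delta>))" using ln4 r0 by simp
    thus ?thesis using sample' unfolding half by linarith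
  qed
  have pair: "(\<lambda>w. (X i w, \<epsilon> i w)) \<in> borel_measurable M" if "i \<in> {1..n}" for i
    using indep that by (simp add: indep_vars_def2)
  have fst_m: "(fst :: (real^'d) \<times> real \<Rightarrow> _) \<in> borel_measurable borel"
    and snd_m: "(snd :: (real^'d) \<times> real \<Rightarrow> _) \<in> borel_measurable borel"
    and mul_m: "(\<lambda>p :: (real^'d) \<times> real. snd p *\<^sub>R fst p) \<in> borel_measurable borel"
    by (intro borel_measurable_continuous_onI continuous_intros)+
  have X: "X i \<in> borel_measurable M" and \<epsilon>: "\<epsilon> i \<in> borel_measurable M" and V: "V i \<in> borel_measurable M"
    if "i \<in> {1..n}" for i
    using measurable_compose[OF pair[OF that] fst_m] measurable_compose[OF pair[OF that] snd_m]
      measurable_compose[OF pair[OF that] mul_m] by (simp_all add: V_def[abs_def])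
  have one: "1 \<in> {1..n}" using n0 by simp
  have indepX: "indep_vars (\<lambda>_. borel) X {1..n}"
    using indep_vars_compose2[OF indep, of "\<lambda>_. fst" "\<lambda>_. borel"] fst_m by simp
  have indepV: "indep_vars (\<lambda>_. borel) V {1..n}"
    using indep_vars_compose2[OF indep, of "\<lambda>_ p. snd p *\<^sub>R fst p" "\<lambda>_. borel"] mul_m by (simp add: V_def[abs_def])
  have push: "distr M borel (\<lambda>w. g (X i w, \<epsilon> i w)) = distr M borel (\<lambda>w. g (X 1 w, \<epsilon> 1 w))"
    if i: "i \<in> {1..n}" and g: "g \<in> borel_measurable borel" for i and g :: "(real^'d) \<times> real \<Rightarrow> real^'d"
    using distr_distr[OF g pair[OF i]] distr_distr[OF g pair[OF one]] ident[OF i] by (simp add: comp_def)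
  have identX: "distr M borel (X i) = distr M borel (X 1)" if "i \<in> {1..n}" for i
    using push[OF that fst_m] by simp
  have identV: "distr M borel (V i) = distr M borel (V 1)" if "i \<in> {1..n}" for i
    using push[OF that mul_m] by (simp add: V_def[abs_def])
  have mean: "expectation (\<lambda>w. x \<bullet> V 1 w) = 0" if int: "integrable M (\<lambda>w. x \<bullet> V 1 w)" for x
  proof -
    have eq: "x \<bullet> V 1 w = (x \<bullet> X 1 w) * \<epsilon> 1 w" for w by (simp add: V_def)
    show ?thesis unfolding eq
      by (rule expectation_mult_cond_exp_zero[OF X[OF one] _ \<epsilon>[OF one] N_cond(2), where f="\<lambda>v. x \<bullet> v"])
        (use int in \<open>simp_all only: eq borel_measurable_inner measurable_ident borel_measurable_const\<close>, measurable)
  qed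
  obtain E1 where E1: "E1 \<in> events" "prob E1 \<ge> 1 - \<delta> / 2"
    and cov: "\<And>w v. w \<in> E1 \<Longrightarrow> (\<Sum>i=1..n. (v \<bullet> X i w)\<^sup>2) \<le> real n * (19 * s0 * (norm v)\<^sup>2)"
    using sample_covariance_bound[OF indepX identX psd inv Q(1) Q(2) _ _ sample] \<delta> unfolding s0_def by auto
  have "\<exists>E\<in>events. prob E \<ge> 1 - \<delta> / 2 \<and>
    (\<forall>w\<in>E. norm ((1 / real n) *\<^sub>R (\<Sum>i=1..n. V i w)) \<le> 15 * c)"
  proof (cases "\<sigma> = 0")
    case True
    hence "psi1_norm_vec M (\<lambda>w. inv_sqrt Sig *v V 1 w) = 0" using N_psi1 by (simp add: V_def)
    from psi1_norm_vec_zero_imp[where V=V and n=n, OF V identV psd inv this]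
    obtain E where E: "E \<in> events" "prob E = 1" "\<And>w i. w \<in> E \<Longrightarrow> i \<in> {1..n} \<Longrightarrow> V i w = 0" by auto
    have "(\<Sum>i=1..n. V i w) = 0" if "w \<in> E" for w using E(3)[OF that] by (intro sum.neutral) auto
    thus ?thesis using E \<delta> True by (intro bexI[of _ E]) (auto simp: c_def)
  next
    case False
    hence "\<sigma> > 0" using N_psi1 by simp
    moreover have "psi1_norm_vec M (\<lambda>w. inv_sqrt Sig *v V 1 w) = ennreal \<sigma>"
      using N_psi1(2) by (simp add: V_def)
    ultimately show ?thesis
      using psi1_norm_vec_mean_bound[where V=V and n=n, OF indepV identV mean psd inv _ _ _ _ sample'] \<delta>
      unfolding half c_def b_def s0_def by (simp add: mult.assoc)
  qed
  then obtain E2 where E2: "E2 \<in> events" "prob E2 \<ge> 1 - \<delta> / 2"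
    and noise: "\<And>w. w \<in> E2 \<Longrightarrow> norm ((1 / real n) *\<^sub>R (\<Sum>i=1..n. V i w)) \<le> 15 * c" by auto
  have c0: "0 \<le> c" using N_psi1(1) s0 by (simp add: c_def b_def ln4 r0 less_imp_le)
  have \<rho>\<mu>: "0 < \<rho>\<^sub>0 * \<mu>" using \<rho>0 pos by simp
  have min4: "2048 * c / (\<rho>\<^sub>0 * \<mu>) \<le> min (lam / s0) L"
    using cond4 unfolding c_def b_def s0_def L_def by (simp add: mult_ac)
  have cL: "2048 * c \<le> \<rho>\<^sub>0 * \<mu> * L" and cs: "2048 * (s0 * c) \<le> \<rho>\<^sub>0 * \<mu> * L\<^sup>2"
  proof -
    show "2048 * c \<le> \<rho>\<^sub>0 * \<mu> * L" using min4 \<rho>\<mu> by (simp add: pos_divide_le_eq mult_ac)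
    have "2048 * c / (\<rho>\<^sub>0 * \<mu>) \<le> L\<^sup>2 / s0" using min4 L by simp
    hence "2048 * c \<le> (L\<^sup>2 / s0) * (\<rho>\<^sub>0 * \<mu>)" using \<rho>\<mu> by (simp only: pos_divide_le_eq)
    hence "s0 * (2048 * c) \<le> s0 * ((L\<^sup>2 / s0) * (\<rho>\<^sub>0 * \<mu>))" using s0 by (intro mult_left_mono) auto
    thus "2048 * (s0 * c) \<le> \<rho>\<^sub>0 * \<mu> * L\<^sup>2" using s0 by (simp add: mult_ac)
  qed
  have goal: "norm (\<theta> T w - \<theta>hat w) \<le> \<rho>\<^sub>0 ^ (2 * (T - 1)) * (a + 8 * c / L)"
    if w: "w \<in> E1 \<inter> E2" for w
  proof -
    have "w \<in> space M" using w E1 sets.sets_into_space by blast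
    then obtain \<eta>' A' where am: "is_arg_min (objective (Z w) (Sighat w) \<mu> lam) (\<lambda>_. True) (\<theta>hat w, \<eta>', A')"
      using \<theta>hat by blast
    define z where "z = norm (Z w - Sighat w *v \<theta>0)"
    define N where "N = a + z / L"
    have "Z w - Sighat w *v \<theta>0 = (1 / real n) *\<^sub>R (\<Sum>i=1..n. V i w)"
    proof -
      have "Sighat w *v \<theta>0 = (1 / real n) *\<^sub>R (\<Sum>i=1..n. (X i w \<bullet> \<theta>0) *\<^sub>R X i w)"
        unfolding Sighat by (simp add: sum_outer_mult_vec flip: scaleR_matrix_vector_assoc)
      moreover have "(\<Sum>i=1..n. Y i w *\<^sub>R X i w) = (\<Sum>i=1..n. (X i w \<bullet> \<theta>0) *\<^sub>R X i w) + (\<Sum>i=1..n. V i w)"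
        unfolding sum.distrib[symmetric] V_def Y by (simp add: scaleR_add_left)
      ultimately show ?thesis unfolding Z by (simp add: scaleR_add_right)
    qed
    hence z: "z \<le> 15 * c" using noise w by (simp add: z_def)
    have z0: "0 \<le> z" by (simp add: z_def)
    have S: "norm (Sighat w *v x) \<le> 19 * s0 * norm x" for x
      unfolding Sighat
    proof (rule norm_gram_mult_le)
      fix v
      have "1 / real n * (\<Sum>i=1..n. (v \<bullet> X i w)\<^sup>2) \<le> 1 / real n * (real n * (19 * s0 * (norm v)\<^sup>2))"
        using cov[of w v] w by (intro mult_left_mono) auto
      thus "1 / real n * (\<Sum>i=1..n. (v \<bullet> X i w)\<^sup>2) \<le> 19 * s0 * (norm v)\<^sup>2" using n0 by simp
    qed (use s0 in auto)
    have zL: "z / L \<le> 15/2048 * (\<rho>\<^sub>0 * \<mu>)" "s0 * (z / L) \<le> 15/2048 * (\<rho>\<^sub>0 * \<mu> * L)"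
    proof -
      have "z \<le> 15/2048 * (\<rho>\<^sub>0 * \<mu>) * L" using z cL by simp
      thus "z / L \<le> 15/2048 * (\<rho>\<^sub>0 * \<mu>)" using L by (simp add: pos_divide_le_eq)
      have "s0 * z \<le> s0 * (15 * c)" using z s0 by (intro mult_left_mono) auto
      also have "\<dots> \<le> 15/2048 * (\<rho>\<^sub>0 * \<mu> * L\<^sup>2)" using cs by (simp add: mult_ac)
      finally show "s0 * (z / L) \<le> 15/2048 * (\<rho>\<^sub>0 * \<mu> * L)"
        using L by (simp add: pos_divide_le_eq power2_eq_square mult_ac)
    qed
    have a1: "a \<le> 1/7 * (\<rho>\<^sub>0 * \<mu>)" and a2: "s0 * a \<le> 1/1008 * (\<rho>\<^sub>0 * \<mu> * L)"
      using cond1 cond2 unfolding a_def s0_def L_def by simp_all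
    \<comment> \<open>This uses \<open>1/7 + 15/2048 < 1/6\<close>; the next inequality uses \<open>95/1008 + 95 * 15/2048 + 15/2048 < 1\<close>.\<close>
    have N1: "N \<le> \<rho>\<^sub>0 * \<mu> / 6" using a1 zL(1) \<rho>\<mu> unfolding N_def by linarith
    have N2: "5 * (19 * s0) * N + z \<le> \<rho>\<^sub>0 * \<mu> * sqrt lam"
    proof -
      have "5 * (19 * s0) * N + z = 95 * (s0 * a) + 95 * (s0 * (z / L)) + z"
        by (simp add: N_def algebra_simps)
      moreover have "0 < \<rho>\<^sub>0 * \<mu> * L" using \<rho>\<mu> L by simp
      ultimately show ?thesis using a2 zL(2) z cL unfolding L_def[symmetric] by linarith
    qed
    have "norm (\<theta> T w - \<theta>hat w) \<le> \<rho>\<^sub>0 ^ (2 * T) * (N / 6)"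
    proof (rule alternating_minimization_contraction[where S="Sighat w" and m="19 * s0" and ?\<theta>0.0=\<theta>0 and Z="Z w"
          and lam=lam and \<mu>=\<mu> and \<eta>h=\<eta>' and Ah=A' and \<theta>="\<lambda>t. \<theta> t w" and A="\<lambda>t. A t w"])
      show "N = norm \<theta>0 + norm (Z w - Sighat w *v \<theta>0) / sqrt lam" by (simp add: N_def a_def z_def L_def)
      show "5 * (19 * s0) * N + norm (Z w - Sighat w *v \<theta>0) \<le> \<rho>\<^sub>0 * \<mu> * sqrt lam" using N2 by (simp add: z_def)
    qed (use pos \<rho>0 s0 S N1 am A_0 \<theta>_t A_t T in auto)
    also have "\<rho>\<^sub>0 ^ (2 * T) = \<rho>\<^sub>0 ^ (2 * (T - 1)) * \<rho>\<^sub>0\<^sup>2"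
    proof -
      have "2 * T = 2 * (T - 1) + 2" using T by simp
      thus ?thesis by (metis power_add)
    qed
    also have "\<rho>\<^sub>0 ^ (2 * (T - 1)) * \<rho>\<^sub>0\<^sup>2 * (N / 6) \<le> \<rho>\<^sub>0 ^ (2 * (T - 1)) * 1 * (a + 8 * c / L)"
    proof -
      have "(a + x) / 6 \<le> a + 8 * y" if "x \<le> 15 * y" "0 \<le> y" "0 \<le> a" for x y :: real
        using that by simp
      moreover have "z / L \<le> 15 * (c / L)" using z L by (simp add: divide_right_mono)
      moreover have "0 \<le> c / L" "0 \<le> a" using c0 L by (auto simp: a_def)
      ultimately have "N / 6 \<le> a + 8 * (c / L)" unfolding N_def by metis
      hence "N / 6 \<le> a + 8 * c / L" by simp
      moreover have "\<rho>\<^sub>0\<^sup>2 \<le> 1" using \<rho>0 by (intro power_le_one) auto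
      moreover have "0 \<le> N" using z0 L by (simp add: N_def a_def)
      ultimately show ?thesis using \<rho>0 by (intro mult_mono) auto
    qed
    finally show ?thesis by simp
  qed
  have rate: "8 * c / L = 8 * \<sigma> * sqrt (op_norm Sig) * sqrt ((eff_rank Sig + ln (4 / \<delta>)) / (lam * real n))"
    by (simp add: c_def b_def s0_def L_def real_sqrt_divide real_sqrt_mult mult_ac)
  have "1 - \<delta> \<le> prob (E1 \<inter> E2)"
  proof -
    have "prob (E1 \<union> E2) = prob E1 + prob E2 - prob (E1 \<inter> E2)"
      using E1(1) E2(1) by (simp add: finite_measure_Union' finite_measure_Diff' Int_commute)
    thus ?thesis using E1(2) E2(2) prob_le_1[of "E1 \<union> E2"] by linarith
  qed
  thus ?thesis using goal E1(1) E2(1) unfolding rate a_def by blast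
qed

end
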